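(* Let $\mathbb{X},\mathbb{Y}$ be finite-dimensional real inner product spaces, let $f\colon\mathbb{X}\to\mathbb{X}$ be differentiable, let $\Phi\colon\mathbb{X}\to\mathbb{Y}$ be twice differentiable, and let $\Theta\subset\mathbb{Y}$ be closed. Put $\Psi(x,\lambda):=f(x)+\nabla\Phi(x)^*\lambda$ and $\Lambda(\bar x):=\{\lambda\in\mathbb{Y}\mid\Psi(\bar x,\lambda)=0,\ \lambda\in N_\Theta(\Phi(\bar x))\}$. Let $\bar x\in\mathbb{X}$ with $\Phi(\bar x)\in\Theta$ satisfy the stationarity condition $0\in f(\bar x)+\partial(\delta_\Theta\circ\Phi)(\bar x)$, let $\Theta$ be $\mathcal{C}^2$-cone reducible at $\bar z=\Phi(\bar x)$ to a closed convex cone $C$, and let the strict complementarity condition hold at $\bar x$: there is $\lambda\in\Lambda(\bar x)$ with $\lambda\in\mathrm{ri}\,N_\Theta(\Phi(\bar x))$. Then a Lagrange multiplier $\bar\lambda\in\Lambda(\bar x)$ is noncritical if and only if either one of the following (equivalent) conditions is satisfied: (ii) There are numbers $\varepsilon>0$, $\ell\ge 0$ and neighborhoods $V$ of $0\in\mathbb{X}$ and $W$ of $0\in\mathbb{Y}$ such that for any $(v,w)\in V\times W$ $$S(v,w)\cap\mathbb{B}_\varepsilon(\bar x,\bar\lambda)\subset\big[\{\bar x\}\times\Lambda(\bar x)\big]+\ell\big(\|v\|+\|w\|\big)\mathbb{B},$$ where $S(v,w):=\{(x,\lambda)\in\mathbb{X}\times\mathbb{Y}\mid v=\Psi(x,\lambda),\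 \lambda\in N_\Theta(\Phi(x)+w)\}$. (iii) There are numbers $\varepsilon>0$ and $\ell\ge 0$ such that $$\|x-\bar x\|+d\big(\lambda;\Lambda(\bar x)\big)\le\ell\Big(\|\Psi(x,\lambda)\|+d\big(\Phi(x);N_\Theta^{-1}(\lambda)\big)\Big)\quad\text{for all }(x,\lambda)\in\mathbb{B}_\varepsilon(\bar x,\bar\lambda).$$
   Context: $\mathbb{B}$ is the closed unit ball of the space in question, $\mathbb{B}_r(x)=x+r\mathbb{B}$; $d(x;\Omega)$ is the distance from $x$ to $\Omega$ ($=\infty$ if $\Omega=\emptyset$); $\mathrm{ri}$ is the relative interior. For a linear operator, $^*$ is the adjoint; for a set $\Omega$, $\Omega^*=\{v\mid\langle v,x\rangle\le 0\ \forall x\in\Omega\}$ is the polar. Tangent cone: $T_\Omega(\bar x)=\{w\mid\exists\,t_k\downarrow0,\ w_k\to w,\ \bar x+t_kw_k\in\Omega\}$ for $\bar x\in\Omega$. Regular normal cone: $\widehat N_\Omega(\bar x)=T_\Omega(\bar x)^*$. (Limiting) normal cone: $N_\Omega(\bar x)=\{v\mid\exists\,x_k\to\bar x,\ x_k\in\Omega,\ v_k\to v,\ v_k\in\widehat N_\Omega(x_k)\}$ for $\bar x\in\Omega$, and $N_\Omega(x)=\emptyset$ for $x\notin\Omega$. $N_\Theta^{-1}(\lambda)=\{z\mid\lambda\in N_\Theta(z)\}$. $\delta_\Theta$ is the indicator function of $\Theta$; the (limiting) subdifferential is $\partial g(\bar x)=\{v\mid(v,-1)\in N_{\mathrm{epi}\,g}(\bar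 x,g(\bar x))\}$; thus $\partial(\delta_\Theta\circ\Phi)(\bar x)=N_{\Phi^{-1}(\Theta)}(\bar x)$. Graphical derivative of $F\colon\mathbb{X}\rightrightarrows\mathbb{Y}$ at $(\bar x,\bar y)\in\mathrm{gph}\,F$: $DF(\bar x,\bar y)(u)=\{v\mid(u,v)\in T_{\mathrm{gph}\,F}(\bar x,\bar y)\}$. Noncritical: $\bar\lambda\in\Lambda(\bar x)$ is noncritical if the only $\xi\in\mathbb{X}$ with $0\in\nabla_x\Psi(\bar x,\bar\lambda)\xi+\nabla\Phi(\bar x)^*DN_\Theta(\Phi(\bar x),\bar\lambda)(\nabla\Phi(\bar x)\xi)$ is $\xi=0$; otherwise it is critical. $\mathcal{C}^2$-cone reducibility: a closed set $\Theta\subset\mathbb{Y}$ is $\mathcal{C}^2$-cone reducible at $\bar z\in\Theta$ to a closed convex cone $C\subset\mathbb{E}$ ($\mathbb{E}$ a finite-dimensional space) if there are a neighborhood $\mathcal{O}$ of $\bar z$ and a $\mathcal{C}^2$-smooth $h\colon\mathbb{Y}\to\mathbb{E}$ with $\Theta\cap\mathcal{O}=\{z\in\mathcal{O}\mid h(z)\in C\}$, $h(\bar z)=0$, and $\nabla h(\bar z)$ surjective. *)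

theory Defs
  imports "HOL-Analysis.Analysis"
begin

section \<open>Tangent and normal cones\<close>

definition tangent_cone :: "'a::euclidean_space set \<Rightarrow> 'a \<Rightarrow> 'a set" where
  "tangent_cone \<Omega> x = {w. \<exists>t ws. (\<forall>k::nat. 0 < t k) \<and> t \<longlonglongrightarrow> (0::real) \<and> ws \<longlonglongrightarrow> w \<and>
     (\<forall>k. x + t k *\<^sub>R ws k \<in> \<Omega>)}"

definition polar_set :: "'a::euclidean_space set \<Rightarrow> 'a set" where
  "polar_set \<Omega> = {v. \<forall>x\<in>\<Omega>. v \<bullet> x \<le> 0}"

definition regular_normal_cone :: "'a::euclidean_space set \<Rightarrow> 'a \<Rightarrow> 'a set" where
  "regular_normal_cone \<Omega> x = polar_set (tangent_cone \<Omega> x)"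

definition normal_cone :: "'a::euclidean_space set \<Rightarrow> 'a \<Rightarrow> 'a set" where
  "normal_cone \<Omega> x =
     (if x \<in> \<Omega> then
        {v. \<exists>xs vs. (\<forall>k::nat. xs k \<in> \<Omega> \<and> vs k \<in> regular_normal_cone \<Omega> (xs k)) \<and>
           xs \<longlonglongrightarrow> x \<and> vs \<longlonglongrightarrow> v}
      else {})"

definition inverse_normal_cone :: "'a::euclidean_space set \<Rightarrow> 'a \<Rightarrow> 'a set" where
  "inverse_normal_cone \<Theta> v = {z. v \<in> normal_cone \<Theta> z}"

section \<open>Subdifferential and graphical derivative\<close>

text \<open>Unlike \<^const>\<open>epigraph\<close>, this is for extended-real-valued functions.\<close>

definition epi :: "('a \<Rightarrow> ereal) \<Rightarrow> ('a \<times> real) set" where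
  "epi g = {(x, \<alpha>). g x \<le> ereal \<alpha>}"

text \<open>The subdifferential is empty where the function is not finite.\<close>

definition subdifferential :: "('a::euclidean_space \<Rightarrow> ereal) \<Rightarrow> 'a \<Rightarrow> 'a set" where
  "subdifferential g x =
     {v. \<bar>g x\<bar> \<noteq> \<infinity> \<and> (v, -1) \<in> normal_cone (epi g) (x, real_of_ereal (g x))}"

definition indicator_fun :: "'a set \<Rightarrow> 'a \<Rightarrow> ereal" where
  "indicator_fun \<Theta> z = (if z \<in> \<Theta> then 0 else \<infinity>)"

definition gph :: "('a \<Rightarrow> 'b set) \<Rightarrow> ('a \<times> 'b) set" where
  "gph F = {(x, y). y \<in> F x}"

definition graphical_derivative ::
  "('a::euclidean_space \<Rightarrow> 'b::euclidean_space set) \<Rightarrow> 'a \<Rightarrow> 'b \<Rightarrow> 'a \<Rightarrow> 'b set" where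
  "graphical_derivative F x y u = {v. (u, v) \<in> tangent_cone (gph F) (x, y)}"

section \<open>Smoothness and reducibility\<close>

definition twice_differentiable :: "('a::euclidean_space \<Rightarrow> 'b::euclidean_space) \<Rightarrow> bool" where
  "twice_differentiable g \<longleftrightarrow>
     (\<exists>D :: 'a \<Rightarrow> 'a \<Rightarrow>\<^sub>L 'b.
        (\<forall>x. (g has_derivative blinfun_apply (D x)) (at x)) \<and>
        (\<forall>x. D differentiable (at x)))"

definition C2_smooth :: "('a::euclidean_space \<Rightarrow> 'b::euclidean_space) \<Rightarrow> bool" where
  "C2_smooth g \<longleftrightarrow>
     (\<exists>(D :: 'a \<Rightarrow> 'a \<Rightarrow>\<^sub>L 'b) (D2 :: 'a \<Rightarrow> 'a \<Rightarrow>\<^sub>L ('a \<Rightarrow>\<^sub>L 'b)).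
        (\<forall>x. (g has_derivative blinfun_apply (D x)) (at x)) \<and>
        (\<forall>x. (D has_derivative blinfun_apply (D2 x)) (at x)) \<and>
        continuous_on UNIV D2)"

text \<open>\<^const>\<open>cone\<close> admits the empty set, but the conditions on \<open>h\<close> and \<open>z \<in> \<Theta>\<close>
  force \<open>0 \<in> C\<close>.\<close>

definition C2_cone_reducible ::
  "'b::euclidean_space set \<Rightarrow> 'b \<Rightarrow> 'e::euclidean_space set \<Rightarrow> bool" where
  "C2_cone_reducible \<Theta> z C \<longleftrightarrow>
     closed \<Theta> \<and> z \<in> \<Theta> \<and> closed C \<and> convex C \<and> cone C \<and>
     (\<exists>U (h :: 'b \<Rightarrow> 'e). open U \<and> z \<in> U \<and> C2_smooth h \<and>
        \<Theta> \<inter> U = {y \<in> U. h y \<in> C} \<and> h z = 0 \<and> surj (frechet_derivative h (at z)))"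

section \<open>The variational system\<close>

definition Psi ::
  "('a::euclidean_space \<Rightarrow> 'a) \<Rightarrow> ('a \<Rightarrow> 'b::euclidean_space) \<Rightarrow> 'a \<Rightarrow> 'b \<Rightarrow> 'a" where
  "Psi f \<Phi> x l = f x + adjoint (frechet_derivative \<Phi> (at x)) l"

definition multipliers ::
  "('a::euclidean_space \<Rightarrow> 'a) \<Rightarrow> ('a \<Rightarrow> 'b::euclidean_space) \<Rightarrow> 'b set \<Rightarrow> 'a \<Rightarrow> 'b set" where
  "multipliers f \<Phi> \<Theta> x = {l. Psi f \<Phi> x l = 0 \<and> l \<in> normal_cone \<Theta> (\<Phi> x)}"

definition stationary ::
  "('a::euclidean_space \<Rightarrow> 'a) \<Rightarrow> ('a \<Rightarrow> 'b::euclidean_space) \<Rightarrow> 'b set \<Rightarrow> 'a \<Rightarrow> bool" where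
  "stationary f \<Phi> \<Theta> x \<longleftrightarrow>
     0 \<in> {f x + v | v. v \<in> subdifferential (indicator_fun \<Theta> \<circ> \<Phi>) x}"

definition strict_complementarity ::
  "('a::euclidean_space \<Rightarrow> 'a) \<Rightarrow> ('a \<Rightarrow> 'b::euclidean_space) \<Rightarrow> 'b set \<Rightarrow> 'a \<Rightarrow> bool" where
  "strict_complementarity f \<Phi> \<Theta> x \<longleftrightarrow>
     (\<exists>l \<in> multipliers f \<Phi> \<Theta> x. l \<in> rel_interior (normal_cone \<Theta> (\<Phi> x)))"

definition noncritical ::
  "('a::euclidean_space \<Rightarrow> 'a) \<Rightarrow> ('a \<Rightarrow> 'b::euclidean_space) \<Rightarrow> 'b set \<Rightarrow> 'a \<Rightarrow> 'b \<Rightarrow> bool" where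
  "noncritical f \<Phi> \<Theta> x l \<longleftrightarrow>
     (\<forall>\<xi>. 0 \<in> {frechet_derivative (\<lambda>y. Psi f \<Phi> y l) (at x) \<xi>
                 + adjoint (frechet_derivative \<Phi> (at x)) \<eta> | \<eta>.
                 \<eta> \<in> graphical_derivative (normal_cone \<Theta>) (\<Phi> x) l
                        (frechet_derivative \<Phi> (at x) \<xi>)}
          \<longleftrightarrow> \<xi> = 0)"

definition solution_map ::
  "('a::euclidean_space \<Rightarrow> 'a) \<Rightarrow> ('a \<Rightarrow> 'b::euclidean_space) \<Rightarrow> 'b set \<Rightarrow> 'a \<Rightarrow> 'b \<Rightarrow> ('a \<times> 'b) set" where
  "solution_map f \<Phi> \<Theta> v w = {(x, l). v = Psi f \<Phi> x l \<and> l \<in> normal_cone \<Theta> (\<Phi> x + w)}"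

text \<open>Unlike \<^const>\<open>infdist\<close>, this distance to the empty set is \<open>\<infinity>\<close>.\<close>

definition ext_dist :: "'a::metric_space \<Rightarrow> 'a set \<Rightarrow> ereal" where
  "ext_dist x \<Omega> = (INF y\<in>\<Omega>. ereal (dist x y))"

definition semi_isolated_calmness ::
  "('a::euclidean_space \<Rightarrow> 'a) \<Rightarrow> ('a \<Rightarrow> 'b::euclidean_space) \<Rightarrow> 'b set \<Rightarrow> 'a \<Rightarrow> 'b \<Rightarrow> bool" where
  "semi_isolated_calmness f \<Phi> \<Theta> xb lb \<longleftrightarrow>
     (\<exists>\<epsilon> c V W. 0 < \<epsilon> \<and> 0 \<le> c \<and> open V \<and> 0 \<in> V \<and> open W \<and> 0 \<in> W \<and>
        (\<forall>v\<in>V. \<forall>w\<in>W.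
           solution_map f \<Phi> \<Theta> v w \<inter> cball (xb, lb) \<epsilon>
             \<subseteq> {p + (c * (norm v + norm w)) *\<^sub>R b | p b.
                  p \<in> {xb} \<times> multipliers f \<Phi> \<Theta> xb \<and> b \<in> cball 0 1}))"

text \<open>In \<^typ>\<open>ereal\<close>, \<open>0 * \<infinity> = 0\<close>; as \<open>c\<close> may be enlarged, this convention does not
  affect the existence of \<open>c\<close>.\<close>

definition error_bound ::
  "('a::euclidean_space \<Rightarrow> 'a) \<Rightarrow> ('a \<Rightarrow> 'b::euclidean_space) \<Rightarrow> 'b set \<Rightarrow> 'a \<Rightarrow> 'b \<Rightarrow> bool" where
  "error_bound f \<Phi> \<Theta> xb lb \<longleftrightarrow>
     (\<exists>\<epsilon> c. 0 < \<epsilon> \<and> 0 \<le> c \<and>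
        (\<forall>(x, l) \<in> cball (xb, lb) \<epsilon>.
           ereal (norm (x - xb)) + ext_dist l (multipliers f \<Phi> \<Theta> xb)
             \<le> ereal c * (ereal (norm (Psi f \<Phi> x l))
                            + ext_dist (\<Phi> x) (inverse_normal_cone \<Theta> l))))"

end

theory Submission
  imports Defs
begin

text \<open>
  Reducibility straightens \<open>\<Theta>\<close> near \<open>z = \<Phi> xb\<close> to \<open>{y. F y \<in> Q}\<close> with \<open>Q\<close> a closed convex cone, \<open>F z = 0\<close>
  and \<open>DF z = id\<close>; with \<open>K\<close> the polar of \<open>Q\<close>, the normals to \<open>\<Theta>\<close> at a nearby \<open>y\<close> are then
  \<open>DF y\<^sup>* \<mu>\<close> with \<open>\<mu> \<in> K\<close> and \<open>\<mu> \<bullet> F y = 0\<close>. If \<open>norm (x - xb)\<close> is not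
  bounded by the residuals near \<open>(xb, lb)\<close>, normalising a violating sequence gives \<open>\<xi> \<noteq> 0\<close> with
  \<open>u = A \<xi> \<in> Q\<close> and \<open>lb \<bullet> u = 0\<close>, where \<open>A\<close> is the derivative of \<open>\<Phi>\<close> at \<open>xb\<close>. A strictly
  complementary \<open>l0\<close> has the same image as \<open>lb\<close> under \<open>A\<^sup>*\<close>, so \<open>l0 \<bullet> u = 0\<close>, and as \<open>l0\<close> is in the
  relative interior of \<open>K\<close>, \<open>u\<close> is orthogonal to the whole span of \<open>K\<close>. The residual equation holds in
  the limit modulo \<open>A\<^sup>*\<close> of this span, which is closed and is also the image of the feasible directions
  of \<open>K\<close> at \<open>lb\<close>; hence \<open>\<xi>\<close> is critical. The distance to the multiplier set
  is controlled by moving an approximate multiplier towards \<open>l0\<close>.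
\<close>

section \<open>Adjoints, derivatives along sequences, tangent cones\<close>

text \<open>Taking bounded operators as arguments makes the adjoint bilinear, so that limits in both
  arguments and derivatives in the operator come from \<open>bounded_bilinear\<close>.\<close>

definition adj :: "('a::euclidean_space \<Rightarrow>\<^sub>L 'b::euclidean_space) \<Rightarrow> 'b \<Rightarrow> 'a" where
  "adj T l = adjoint (blinfun_apply T) l"

lemma inner_adj: "x \<bullet> adj T l = blinfun_apply T x \<bullet> l"
  by (simp add: adj_def adjoint_works blinfun.bounded_linear_right bounded_linear.linear)

lemma adj_inner: "adj T l \<bullet> x = l \<bullet> blinfun_apply T x"
  by (metis inner_adj inner_commute)

lemma adj_id [simp]: "adj id_blinfun l = l"
  by (simp add: vector_eq_ldot[symmetric] inner_adj)

lemma norm_adj_le: "norm (adj T l) \<le> norm T * norm l"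
proof (cases "adj T l = 0")
  case False
  have "norm (adj T l) * norm (adj T l) = blinfun_apply T (adj T l) \<bullet> l"
    by (metis inner_adj power2_norm_eq_inner power2_eq_square)
  also have "\<dots> \<le> norm (blinfun_apply T (adj T l)) * norm l"
    by (rule norm_cauchy_schwarz)
  also have "\<dots> \<le> (norm T * norm (adj T l)) * norm l"
    by (intro mult_right_mono norm_blinfun norm_ge_zero)
  finally have "norm (adj T l) * norm (adj T l) \<le> norm (adj T l) * (norm T * norm l)"
    by (simp add: mult_ac)
  with False show ?thesis by simp
qed simp

lemma bounded_bilinear_adj: "bounded_bilinear adj"
proof
  show "\<exists>K. \<forall>a b. norm (adj a b) \<le> norm a * norm b * K"
    by (rule exI[of _ 1]) (simp add: norm_adj_le)
qed (simp_all add: vector_eq_ldot[symmetric] inner_adj inner_right_distrib blinfun.bilinear_simps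
       inner_left_distrib)

interpretation adj: bounded_bilinear adj
  by (rule bounded_bilinear_adj)

text \<open>The directions vary with \<open>n\<close>, as they do in tangent cones and in normalised
  sequences.\<close>

lemma has_derivative_sequentially:
  fixes g :: "'a::real_normed_vector \<Rightarrow> 'b::real_normed_vector"
  assumes g: "(g has_derivative g') (at a)"
    and t: "t \<longlonglongrightarrow> (0::real)" "\<And>n::nat. 0 < t n" and \<xi>: "\<xi> \<longlonglongrightarrow> x"
  shows "(\<lambda>n. (g (a + t n *\<^sub>R \<xi> n) - g a) /\<^sub>R t n) \<longlonglongrightarrow> g' x"
proof -
  from g obtain e where lin: "bounded_linear g'" and e: "\<And>h. g (a + h) = g a + g' h + e h"
    and lim: "((\<lambda>h. norm (e h) / norm h) \<longlongrightarrow> 0) (at 0)"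
    unfolding has_derivative_iff_Ex by blast
  interpret g': bounded_linear g' by (fact lin)
  have e0: "e 0 = 0" using e[of 0] by (simp add: g'.zero)
  \<comment> \<open>Since division by zero yields 0, the quotient takes its limit value at 0, and
    the limit passes along sequences that hit \<open>\<xi> n = 0\<close>.\<close>
  have "isCont (\<lambda>h. norm (e h) / norm h) 0"
    using lim by (simp add: isCont_def)
  moreover have "(\<lambda>n. t n *\<^sub>R \<xi> n) \<longlonglongrightarrow> 0"
    using tendsto_scaleR[OF t(1) \<xi>] by simp
  ultimately have "(\<lambda>n. norm (e (t n *\<^sub>R \<xi> n)) / norm (t n *\<^sub>R \<xi> n)) \<longlonglongrightarrow> 0"
    using isCont_tendsto_compose[of 0 "\<lambda>h. norm (e h) / norm h"] by force
  from tendsto_mult[OF this tendsto_norm[OF \<xi>]]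
  have lim': "(\<lambda>n. norm (e (t n *\<^sub>R \<xi> n)) / norm (t n *\<^sub>R \<xi> n) * norm (\<xi> n)) \<longlonglongrightarrow> 0" by simp
  have eq: "norm (e (t n *\<^sub>R \<xi> n)) / norm (t n *\<^sub>R \<xi> n) * norm (\<xi> n)
      = norm (e (t n *\<^sub>R \<xi> n) /\<^sub>R t n)" for n
    using t(2)[of n] by (cases "\<xi> n = 0") (auto simp: e0 field_simps)
  have *: "(\<lambda>n. e (t n *\<^sub>R \<xi> n) /\<^sub>R t n) \<longlonglongrightarrow> 0"
    using lim' unfolding eq by (rule tendsto_norm_zero_cancel)
  have "(g (a + t n *\<^sub>R \<xi> n) - g a) /\<^sub>R t n = g' (\<xi> n) + e (t n *\<^sub>R \<xi> n) /\<^sub>R t n" for n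
    using t(2)[of n] by (simp add: e g'.scaleR algebra_simps)
  then show ?thesis
    using tendsto_add[OF g'.tendsto[OF \<xi>] *] by simp
qed

lemma has_derivative_calm:
  fixes g :: "'a::real_normed_vector \<Rightarrow> 'b::real_normed_vector"
  assumes "(g has_derivative g') (at a)"
  obtains c d where "0 \<le> c" "0 < d" "\<And>y. norm (y - a) < d \<Longrightarrow> norm (g y - g a) \<le> c * norm (y - a)"
proof -
  from assms have lin: "bounded_linear g'" and "\<forall>e>0. \<exists>d>0. \<forall>y. norm (y - a) < d \<longrightarrow>
      norm (g y - g a - g' (y - a)) \<le> e * norm (y - a)"
    by (auto simp: has_derivative_at_alt)
  then obtain d where d: "0 < d" "\<And>y. norm (y - a) < d \<Longrightarrow>
      norm (g y - g a - g' (y - a)) \<le> 1 * norm (y - a)"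
    by (meson zero_less_one)
  obtain k where k: "0 \<le> k" "\<And>h. norm (g' h) \<le> norm h * k"
    using bounded_linear.nonneg_bounded[OF lin] by blast
  show ?thesis
  proof (rule that[of "1 + k" d])
    fix y assume "norm (y - a) < d"
    with d(2)[of y] k(2)[of "y - a"] show "norm (g y - g a) \<le> (1 + k) * norm (y - a)"
      using norm_triangle_ineq[of "g y - g a - g' (y - a)" "g' (y - a)"]
      by (simp add: algebra_simps)
  qed (use k d in auto)
qed

section \<open>Tangent cones, their images, and regular normals\<close>

lemma tangent_cone_eventuallyI:
  assumes "\<And>k. 0 < t k" "t \<longlonglongrightarrow> (0::real)" "ws \<longlonglongrightarrow> w"
    and ev: "\<forall>\<^sub>F k in sequentially. x + t k *\<^sub>R ws k \<in> \<Omega>"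
  shows "w \<in> tangent_cone \<Omega> x"
proof -
  from ev obtain N where N: "\<And>k. N \<le> k \<Longrightarrow> x + t k *\<^sub>R ws k \<in> \<Omega>"
    by (auto simp: eventually_sequentially)
  show ?thesis
    unfolding tangent_cone_def
    using assms(1) LIMSEQ_ignore_initial_segment[OF assms(2), of N]
      LIMSEQ_ignore_initial_segment[OF assms(3), of N] N
    by (intro CollectI exI[of _ "\<lambda>k. t (k + N)"] exI[of _ "\<lambda>k. ws (k + N)"]) auto
qed

lemma tangent_coneE:
  assumes "w \<in> tangent_cone \<Omega> x"
  obtains t ws where "\<And>k::nat. 0 < t k" "t \<longlonglongrightarrow> (0::real)" "ws \<longlonglongrightarrow> w"
    "\<And>k. x + t k *\<^sub>R ws k \<in> \<Omega>"
  using assms by (auto simp: tangent_cone_def)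

text \<open>The difference quotients of \<open>g\<close> along the given sequence converge to
  \<open>G w\<close> and serve as directions. Mapping \<open>Q\<close> into \<open>\<Theta>\<close>
  is asked only near \<open>y\<close>, which suits a local inverse.\<close>

lemma tangent_cone_image:
  assumes w: "w \<in> tangent_cone Q y" and g: "(g has_derivative G) (at y)"
    and ev: "\<forall>\<^sub>F y' in nhds y. y' \<in> Q \<longrightarrow> g y' \<in> \<Theta>"
  shows "G w \<in> tangent_cone \<Theta> (g y)"
proof -
  obtain t ws where t: "\<And>k::nat. 0 < t k" "t \<longlonglongrightarrow> (0::real)" and ws: "ws \<longlonglongrightarrow> w"
    and Q: "\<And>k. y + t k *\<^sub>R ws k \<in> Q"
    using w by (rule tangent_coneE) blast
  have "(\<lambda>k. y + t k *\<^sub>R ws k) \<longlonglongrightarrow> y"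
    using tendsto_add[OF tendsto_const tendsto_scaleR[OF t(2) ws], of y] by simp
  with ev have "\<forall>\<^sub>F k in sequentially. g (y + t k *\<^sub>R ws k) \<in> \<Theta>"
    using Q by (auto simp: filterlim_iff)
  moreover have "g y + t k *\<^sub>R ((g (y + t k *\<^sub>R ws k) - g y) /\<^sub>R t k) = g (y + t k *\<^sub>R ws k)" for k
    using t(1)[of k] by simp
  ultimately show ?thesis
    by (intro tangent_cone_eventuallyI[OF t has_derivative_sequentially[OF g t(2,1) ws]]) simp
qed

lemma regular_normal_cone_subset_normal_cone:
  "x \<in> \<Omega> \<Longrightarrow> regular_normal_cone \<Omega> x \<subseteq> normal_cone \<Omega> x"
  by (auto simp: normal_cone_def intro!: exI[of _ "\<lambda>_. x"] exI[of _ "\<lambda>_. v" for v])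

text \<open>The function \<open>\<mu> \<bullet> F y\<close> is nonpositive on
  \<open>\<Theta>\<close> near \<open>z\<close> and vanishes at \<open>z\<close>, so its gradient
  \<open>adj T \<mu>\<close> is nonpositive on the tangents at this maximum.\<close>

lemma adj_polar_in_normal_cone:
  fixes F :: "'a::euclidean_space \<Rightarrow> 'b::euclidean_space"
  assumes U: "open U" "z \<in> \<Theta> \<inter> U" and sub: "\<And>y. y \<in> \<Theta> \<inter> U \<Longrightarrow> F y \<in> Q"
    and F: "(F has_derivative blinfun_apply T) (at z)"
    and \<mu>: "\<mu> \<in> polar_set Q" "\<mu> \<bullet> F z = 0"
  shows "adj T \<mu> \<in> normal_cone \<Theta> z"
proof -
  have "adj T \<mu> \<bullet> w \<le> 0" if w: "w \<in> tangent_cone \<Theta> z" for w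
  proof -
    obtain t ws where t: "\<And>k::nat. 0 < t k" "t \<longlonglongrightarrow> (0::real)" and ws: "ws \<longlonglongrightarrow> w"
      and \<Theta>: "\<And>k. z + t k *\<^sub>R ws k \<in> \<Theta>"
      using w by (rule tangent_coneE) blast
    have "(\<lambda>k. z + t k *\<^sub>R ws k) \<longlonglongrightarrow> z"
      using tendsto_add[OF tendsto_const tendsto_scaleR[OF t(2) ws], of z] by simp
    then have "\<forall>\<^sub>F k in sequentially. z + t k *\<^sub>R ws k \<in> U"
      using U by (auto intro: topological_tendstoD)
    then have "\<forall>\<^sub>F k in sequentially. \<mu> \<bullet> ((F (z + t k *\<^sub>R ws k) - F z) /\<^sub>R t k) \<le> 0"
    proof eventually_elim
      case (elim k)
      then have "\<mu> \<bullet> F (z + t k *\<^sub>R ws k) \<le> 0"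
        using \<mu>(1) sub \<Theta> by (auto simp: polar_set_def)
      then show ?case
        using t(1)[of k] \<mu>(2) by (simp add: inner_diff_right mult_nonneg_nonpos)
    qed
    moreover have "(\<lambda>k. \<mu> \<bullet> ((F (z + t k *\<^sub>R ws k) - F z) /\<^sub>R t k)) \<longlonglongrightarrow> \<mu> \<bullet> blinfun_apply T w"
      by (intro tendsto_intros has_derivative_sequentially[OF F t(2,1) ws])
    ultimately show ?thesis
      using tendsto_upperbound by (force simp: adj_inner)
  qed
  then have "adj T \<mu> \<in> regular_normal_cone \<Theta> z"
    by (simp add: regular_normal_cone_def polar_set_def)
  with U show ?thesis
    using regular_normal_cone_subset_normal_cone by blast
qed

text \<open>Tested on these directions, a vector polar to the tangent cone is seen to be polar to
  \<open>Q\<close> and orthogonal to \<open>y\<close>.\<close>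

lemma convex_cone_tangents:
  assumes Q: "convex Q" "cone Q" and y: "y \<in> Q"
  shows "Q \<subseteq> tangent_cone Q y" "- y \<in> tangent_cone Q y"
proof -
  have lim: "(\<lambda>k. 1 / real (Suc k)) \<longlonglongrightarrow> 0"
    by (rule LIMSEQ_Suc[OF lim_1_over_n])
  show "Q \<subseteq> tangent_cone Q y"
  proof
    fix w assume "w \<in> Q"
    then have "y + (1 / real (Suc k)) *\<^sub>R w \<in> Q" for k
      using Q y convex_cone[of Q] by (meson mem_cone of_nat_0_le_iff zero_le_divide_1_iff)
    then show "w \<in> tangent_cone Q y"
      by (intro tangent_cone_eventuallyI[OF _ lim tendsto_const]) auto
  qed
  have "y + (1 / real (Suc k)) *\<^sub>R (- y) = (1 - 1 / real (Suc k)) *\<^sub>R y" for k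
    by (simp add: algebra_simps)
  then have "y + (1 / real (Suc k)) *\<^sub>R (- y) \<in> Q" for k
    using Q y by (simp add: mem_cone)
  then show "- y \<in> tangent_cone Q y"
    by (intro tangent_cone_eventuallyI[OF _ lim tendsto_const]) auto
qed

text \<open>\<open>adj T\<close> moves each vector by at most half its norm; it is therefore
  injective, and in finite dimension surjective.\<close>

lemma near_identity_bounds:
  fixes T :: "'a::euclidean_space \<Rightarrow>\<^sub>L 'a"
  assumes "norm (T - id_blinfun) \<le> 1/2"
  shows "norm \<mu> \<le> 2 * norm (adj T \<mu>)" "surj (adj T)"
proof -
  have *: "norm \<mu> \<le> 2 * norm (adj T \<mu>)" for \<mu>
  proof -
    have "norm (adj T \<mu> - \<mu>) \<le> norm (T - id_blinfun) * norm \<mu>"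
      using norm_adj_le[of "T - id_blinfun" \<mu>] by (simp add: adj.diff_left)
    also have "\<dots> \<le> 1/2 * norm \<mu>" by (intro mult_right_mono assms) simp
    finally show ?thesis
      using norm_triangle_ineq[of "adj T \<mu>" "\<mu> - adj T \<mu>"] by (simp add: norm_minus_commute)
  qed
  show "norm \<mu> \<le> 2 * norm (adj T \<mu>)" by (fact *)
  have lin: "linear (adj T)" by (simp add: adj.bounded_linear_right bounded_linear.linear)
  have "x = 0" if "adj T x = 0" for x
    using *[of x] that by simp
  then have "inj (adj T)"
    by (simp add: linear_injective_0[OF lin])
  then show "surj (adj T)" using lin by (simp add: linear_injective_imp_surjective)
qed

text \<open>The lower bound from \<open>near_identity_bounds\<close> is uniform in \<open>k\<close>,
  so multipliers converge as soon as the normals they represent do.\<close>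

lemma adj_tendsto_cancel:
  fixes T :: "nat \<Rightarrow> 'a::euclidean_space \<Rightarrow>\<^sub>L 'a"
  assumes lim: "(\<lambda>k. adj (T k) (m k)) \<longlonglongrightarrow> adj S \<mu>" and T: "T \<longlonglongrightarrow> S"
    and near: "\<And>k. norm (T k - id_blinfun) \<le> 1/2"
  shows "m \<longlonglongrightarrow> \<mu>"
proof -
  have "(\<lambda>k. adj (T k) (m k) - adj (T k) \<mu>) \<longlonglongrightarrow> adj S \<mu> - adj S \<mu>"
    by (intro tendsto_diff lim adj.tendsto T tendsto_const)
  then have "(\<lambda>k. adj (T k) (m k - \<mu>)) \<longlonglongrightarrow> 0"
    by (simp add: adj.diff_right)
  from tendsto_mult_right_zero[OF tendsto_norm_zero[OF this], of 2]
  have "(\<lambda>k. 2 * norm (adj (T k) (m k - \<mu>))) \<longlonglongrightarrow> 0" .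
  then have "(\<lambda>k. m k - \<mu>) \<longlonglongrightarrow> 0"
    by (rule Lim_null_comparison[rotated]) (use near_identity_bounds(1)[OF near] in auto)
  then show ?thesis by (simp add: LIM_zero_iff)
qed

section \<open>Straightening a reducible set\<close>

text \<open>\<open>F\<close> maps into the space of \<open>\<Theta>\<close> itself, which makes it a
  local diffeomorphism at \<open>zb\<close> where the reducing map is only a submersion; with
  derivative the identity at \<open>zb\<close>, normals there need no change of coordinates.\<close>

locale straightened_set =
  fixes \<Theta> U Q :: "'b::euclidean_space set" and F :: "'b \<Rightarrow> 'b"
    and DF :: "'b \<Rightarrow> 'b \<Rightarrow>\<^sub>L 'b" and DDF :: "'b \<Rightarrow> 'b \<Rightarrow>\<^sub>L 'b" and zb :: 'b
  assumes closed_Q: "closed Q" and convex_Q: "convex Q" and cone_Q: "cone Q"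
    and open_U: "open U" and zb_U: "zb \<in> U" and \<Theta>_U: "\<Theta> \<inter> U = {y \<in> U. F y \<in> Q}"
    and zb_\<Theta>: "zb \<in> \<Theta>" and F_zb: "F zb = 0"
    and DF: "\<And>z. (F has_derivative blinfun_apply (DF z)) (at z)"
    and DF_zb: "DF zb = id_blinfun"
    and continuous_DF: "continuous_on UNIV DF"
    and DDF: "(DF has_derivative DDF) (at zb)"

text \<open>With \<open>R\<close> a right inverse of the derivative \<open>B\<close> of \<open>h\<close> at \<open>z\<close>, the map
  \<open>F y = R (h y) + (y - z) - R (B (y - z))\<close> has derivative \<open>id\<close> at \<open>z\<close> and satisfies \<open>B \<circ> F = h\<close>, so
  \<open>Q\<close> is the preimage of \<open>C\<close> under \<open>B\<close>.\<close>

lemma C2_cone_reducible_straightened: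
  fixes \<Theta> :: "'b::euclidean_space set" and C :: "'e::euclidean_space set"
  assumes "C2_cone_reducible \<Theta> z C"
  obtains U Q F DF DDF where "straightened_set \<Theta> U Q F DF DDF z"
proof -
  from assms obtain U and h :: "'b \<Rightarrow> 'e" where z: "z \<in> \<Theta>" and C: "closed C" "convex C" "cone C"
    and U: "open U" "z \<in> U" "\<Theta> \<inter> U = {y \<in> U. h y \<in> C}" and h: "C2_smooth h" "h z = 0"
    and surj: "surj (frechet_derivative h (at z))"
    unfolding C2_cone_reducible_def by blast
  from h(1) obtain D :: "'b \<Rightarrow> 'b \<Rightarrow>\<^sub>L 'e" and D2 where
    D: "\<And>x. (h has_derivative blinfun_apply (D x)) (at x)"
    and D2: "\<And>x. (D has_derivative blinfun_apply (D2 x)) (at x)"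
    unfolding C2_smooth_def by blast
  have lin: "linear (blinfun_apply (D z))"
    by (simp add: blinfun.bounded_linear_right bounded_linear.linear)
  have "surj (blinfun_apply (D z))"
    using surj frechet_derivative_at[OF D[of z]] by simp
  from linear_surjective_right_inverse[OF lin this]
  obtain R' where R': "linear R'" "blinfun_apply (D z) \<circ> R' = id" by blast
  define R where "R = Blinfun R'"
  have R: "blinfun_apply R = R'"
    unfolding R_def using R'(1) by (simp add: bounded_linear_Blinfun_apply linear_conv_bounded_linear)
  have DR: "blinfun_apply (D z) (blinfun_apply R e) = e" for e
    using R'(2) by (metis R comp_apply id_apply)
  define Q where "Q = {q. blinfun_apply (D z) q \<in> C}"
  define F where "F y = blinfun_apply R (h y) + (y - z) - blinfun_apply R (blinfun_apply (D z) (y - z))" for y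
  define DF where "DF y = (R o\<^sub>L D y) + id_blinfun - (R o\<^sub>L D z)" for y
  have DzF: "blinfun_apply (D z) (F y) = h y" for y
    by (simp add: F_def DR blinfun.bilinear_simps)
  have dDF: "(DF has_derivative (\<lambda>u. R o\<^sub>L D2 y u)) (at y)" for y
    unfolding DF_def by (auto intro!: derivative_eq_intros D2
      bounded_linear.has_derivative[OF bounded_bilinear.bounded_linear_right[OF bounded_bilinear_blinfun_compose]])
  have "bounded_linear (\<lambda>u. R o\<^sub>L D2 z u)"
    using dDF[of z] by (rule has_derivative_bounded_linear)
  then have DDF: "(DF has_derivative blinfun_apply (Blinfun (\<lambda>u. R o\<^sub>L D2 z u))) (at z)"
    using dDF[of z] by (simp add: bounded_linear_Blinfun_apply)
  have "straightened_set \<Theta> U Q F DF (blinfun_apply (Blinfun (\<lambda>u. R o\<^sub>L D2 z u))) z"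
  proof
    have Q_vim: "Q = blinfun_apply (D z) -` C" by (auto simp: Q_def)
    show "closed Q"
      unfolding Q_vim by (rule closed_vimage[OF C(1)]) (intro continuous_intros)
    show "convex Q"
      unfolding Q_vim by (rule convex_linear_vimage[OF lin C(2)])
    show "cone Q"
      using C(3) by (auto simp: Q_def cone_def blinfun.bilinear_simps)
    show "\<Theta> \<inter> U = {y \<in> U. F y \<in> Q}"
      using U(3) by (simp add: Q_def DzF)
    show "F z = 0" by (simp add: F_def h)
    show "(F has_derivative blinfun_apply (DF y)) (at y)" for y
      unfolding F_def DF_def
      by (auto intro!: derivative_eq_intros D bounded_linear.has_derivative[OF blinfun.bounded_linear_right]
          simp: blinfun.bilinear_simps)
    show "DF z = id_blinfun" by (simp add: DF_def)
    show "continuous_on UNIV DF"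
      using dDF by (meson has_derivative_continuous_on has_derivative_at_withinI)
  qed (use z U DDF in auto)
  then show ?thesis by (rule that)
qed

context straightened_set
begin

lemma mem_\<Theta>_iff: "y \<in> U \<Longrightarrow> y \<in> \<Theta> \<longleftrightarrow> F y \<in> Q"
  using \<Theta>_U by (metis (mono_tags, lifting) IntD1 IntI mem_Collect_eq)

lemma local_inverse:
  obtains W V g G where "open W" "W \<subseteq> U" "zb \<in> W" "open V" "0 \<in> V" "homeomorphism W V F g"
    "\<And>y. y \<in> V \<Longrightarrow> (g has_derivative G y) (at y)"
    "\<And>y. y \<in> V \<Longrightarrow> G y = inv (blinfun_apply (DF (g y)))"
    "\<And>y. y \<in> V \<Longrightarrow> bij (blinfun_apply (DF (g y)))"
proof -
  have "id_blinfun o\<^sub>L DF zb = id_blinfun" by (simp add: DF_zb blinfun_eqI)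
  from inverse_function_theorem[OF open_U DF continuous_on_subset[OF continuous_DF subset_UNIV] zb_U this]
  show ?thesis using that F_zb by metis
qed

section \<open>The polar of \<open>Q\<close> and the normals to \<open>\<Theta>\<close> near
  \<open>zb\<close>\<close>

lemma zero_polar: "0 \<in> polar_set Q"
  by (simp add: polar_set_def)

lemma convex_polar: "convex (polar_set Q)" and cone_polar: "cone (polar_set Q)"
  by (auto simp: convex_def cone_def polar_set_def inner_add_left intro!: add_nonpos_nonpos mult_nonneg_nonpos)

lemma closed_polar: "closed (polar_set Q)"
proof -
  have "polar_set Q = (\<Inter>x\<in>Q. {v. v \<bullet> x \<le> 0})" by (auto simp: polar_set_def)
  then show ?thesis by (auto intro!: closed_Collect_le continuous_intros)
qed

text \<open>For a regular normal, tangents of \<open>Q\<close> carried over by the local inverse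
  show that its multiplier is polar to \<open>Q\<close> and orthogonal to \<open>F z\<close>. For a
  limiting normal, the multipliers of the approximating regular normals converge by
  \<open>adj_tendsto_cancel\<close>, and both properties survive the limit. The converse is
  \<open>adj_polar_in_normal_cone\<close>.\<close>

lemma normal_cone_near:
  obtains r where "0 < r" "\<And>z. z \<in> ball zb r \<Longrightarrow> norm (DF z - id_blinfun) \<le> 1/2"
    "\<And>z. z \<in> \<Theta> \<inter> ball zb r \<Longrightarrow>
       F z \<in> Q \<and> normal_cone \<Theta> z = {adj (DF z) \<mu> |\<mu>. \<mu> \<in> polar_set Q \<and> \<mu> \<bullet> F z = 0}"
proof -
  obtain W V g G where W: "open W" "W \<subseteq> U" "zb \<in> W" and V: "open V" "0 \<in> V"
    and hom: "homeomorphism W V F g"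
    and G: "\<And>y. y \<in> V \<Longrightarrow> (g has_derivative G y) (at y)"
      "\<And>y. y \<in> V \<Longrightarrow> G y = inv (blinfun_apply (DF (g y)))"
      "\<And>y. y \<in> V \<Longrightarrow> bij (blinfun_apply (DF (g y)))"
    by (rule local_inverse) blast
  have contDF: "isCont DF z" for z
    using continuous_DF by (simp add: continuous_on_eq_continuous_at)
  have contF: "isCont F z" for z
    using DF by (rule has_derivative_continuous)
  obtain d where d: "0 < d" "\<And>z. dist z zb < d \<Longrightarrow> dist (DF z) (DF zb) < 1/2"
    using contDF[of zb] unfolding continuous_at_eps_delta by (metis half_gt_zero zero_less_one)
  obtain e where e: "0 < e" "ball zb e \<subseteq> W"
    using W openE by blast
  define r where "r = min d e"
  have r: "0 < r" using d e by (simp add: r_def)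
  have near: "norm (DF z - id_blinfun) \<le> 1/2" if "z \<in> ball zb r" for z
    using d(2)[of z] that by (simp add: r_def dist_norm dist_commute DF_zb norm_minus_commute)
  have rW: "z \<in> W" if "z \<in> ball zb r" for z
    using that e by (auto simp: r_def)
  have reg: "\<exists>\<mu>\<in>polar_set Q. \<mu> \<bullet> F z = 0 \<and> v = adj (DF z) \<mu>"
    if z: "z \<in> \<Theta> \<inter> ball zb r" and v: "v \<in> regular_normal_cone \<Theta> z" for z v
  proof -
    have zW: "z \<in> W" and FV: "F z \<in> V" and gF: "g (F z) = z"
      using z rW hom by (auto simp: homeomorphism_def)
    have FQ: "F z \<in> Q" using z zW W mem_\<Theta>_iff by blast
    obtain \<mu> where \<mu>: "v = adj (DF z) \<mu>"
      using near_identity_bounds(2)[OF near[of z]] z by blast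
    have ev: "\<forall>\<^sub>F y in nhds (F z). y \<in> Q \<longrightarrow> g y \<in> \<Theta>"
    proof -
      have "\<forall>\<^sub>F y in nhds (F z). y \<in> V" using V(1) FV by (rule eventually_nhds_in_open)
      then show ?thesis
      proof eventually_elim
        case (elim y)
        then have "g y \<in> U" "F (g y) = y" using hom W by (auto simp: homeomorphism_def)
        then show ?case using mem_\<Theta>_iff by simp
      qed
    qed
    have le: "\<mu> \<bullet> w \<le> 0" if w: "w \<in> tangent_cone Q (F z)" for w
    proof -
      have "G (F z) w \<in> tangent_cone \<Theta> z"
        using tangent_cone_image[OF w G(1)[OF FV] ev] by (simp add: gF)
      then have "v \<bullet> G (F z) w \<le> 0"
        using v by (auto simp: regular_normal_cone_def polar_set_def)
      \<comment> \<open>The derivative of the local inverse undoes \<open>DF z\<close>, so testing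
        \<open>v\<close> on the carried tangent is testing \<open>\<mu>\<close> on
        \<open>w\<close>.\<close>
      moreover have "blinfun_apply (DF z) (G (F z) w) = w"
        using G(2,3)[OF FV] by (simp add: gF bij_is_surj surj_f_inv_f)
      ultimately show ?thesis by (simp add: \<mu> adj_inner)
    qed
    note tan = convex_cone_tangents[OF convex_Q cone_Q FQ]
    have "\<mu> \<in> polar_set Q" using le tan(1) by (auto simp: polar_set_def)
    moreover have "\<mu> \<bullet> F z = 0" using le[OF tan(2)] le[of "F z"] tan(1) FQ by fastforce
    ultimately show ?thesis using \<mu> by blast
  qed
  show ?thesis
  proof (rule that[OF r near])
    fix z assume z: "z \<in> \<Theta> \<inter> ball zb r"
    have FQ: "F z \<in> Q" using z rW W mem_\<Theta>_iff by blast
    have "v \<in> {adj (DF z) \<mu> |\<mu>. \<mu> \<in> polar_set Q \<and> \<mu> \<bullet> F z = 0}" if v: "v \<in> normal_cone \<Theta> z" for v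
    proof -
      obtain xs vs where xs: "\<And>k. xs k \<in> \<Theta>" "\<And>k::nat. vs k \<in> regular_normal_cone \<Theta> (xs k)"
        "xs \<longlonglongrightarrow> z" "vs \<longlonglongrightarrow> v"
        using v by (auto simp: normal_cone_def split: if_splits)
      obtain \<mu> where \<mu>: "v = adj (DF z) \<mu>"
        using near_identity_bounds(2)[OF near[of z]] z by blast
      have "\<forall>\<^sub>F k in sequentially. xs k \<in> ball zb r"
        using topological_tendstoD[OF xs(3) open_ball] z by blast
      then obtain N where N: "\<And>k. N \<le> k \<Longrightarrow> xs k \<in> ball zb r"
        by (auto simp: eventually_sequentially)
      define y where "y k = xs (k + N)" for k
      have y: "y k \<in> \<Theta> \<inter> ball zb r" for k using N[of "k + N"] xs(1) by (simp add: y_def)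
      have ylim: "y \<longlonglongrightarrow> z" unfolding y_def using xs(3) by (rule LIMSEQ_ignore_initial_segment)
      have vlim: "(\<lambda>k. vs (k + N)) \<longlonglongrightarrow> v" using xs(4) by (rule LIMSEQ_ignore_initial_segment)
      have "\<forall>k. \<exists>m\<in>polar_set Q. m \<bullet> F (y k) = 0 \<and> vs (k + N) = adj (DF (y k)) m"
        using reg[OF y] xs(2) by (simp add: y_def)
      then obtain m where m: "\<And>k. m k \<in> polar_set Q" "\<And>k. m k \<bullet> F (y k) = 0"
        "\<And>k. vs (k + N) = adj (DF (y k)) (m k)" by metis
      have "(\<lambda>k. adj (DF (y k)) (m k)) \<longlonglongrightarrow> adj (DF z) \<mu>"
        using vlim by (simp add: m(3) \<mu>)
      moreover have "(\<lambda>k. DF (y k)) \<longlonglongrightarrow> DF z"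
        using contDF ylim by (rule isCont_tendsto_compose)
      moreover have "norm (DF (y k) - id_blinfun) \<le> 1/2" for k
        using near y by simp
      ultimately have mlim: "m \<longlonglongrightarrow> \<mu>" by (rule adj_tendsto_cancel)
      have "\<mu> \<in> polar_set Q" using closed_sequentially[OF closed_polar m(1) mlim] .
      moreover have "(\<lambda>k. m k \<bullet> F (y k)) \<longlonglongrightarrow> \<mu> \<bullet> F z"
        by (intro tendsto_inner mlim isCont_tendsto_compose[OF contF ylim])
      then have "\<mu> \<bullet> F z = 0" by (simp add: m(2) LIMSEQ_const_iff)
      ultimately show ?thesis using \<mu> by blast
    qed
    moreover have "adj (DF z) \<mu> \<in> normal_cone \<Theta> z" if "\<mu> \<in> polar_set Q" "\<mu> \<bullet> F z = 0" for \<mu>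
      by (rule adj_polar_in_normal_cone[OF open_U _ _ DF that]) (use z rW W mem_\<Theta>_iff in blast)+
    ultimately show "F z \<in> Q \<and> normal_cone \<Theta> z = {adj (DF z) \<mu> |\<mu>. \<mu> \<in> polar_set Q \<and> \<mu> \<bullet> F z = 0}"
      using FQ by blast
  qed
qed

lemma normal_cone_zb: "normal_cone \<Theta> zb = polar_set Q"
proof -
  obtain r where "0 < r" "\<And>z. z \<in> \<Theta> \<inter> ball zb r \<Longrightarrow>
       F z \<in> Q \<and> normal_cone \<Theta> z = {adj (DF z) \<mu> |\<mu>. \<mu> \<in> polar_set Q \<and> \<mu> \<bullet> F z = 0}"
    by (rule normal_cone_near) blast
  then have "normal_cone \<Theta> zb = {adj (DF zb) \<mu> |\<mu>. \<mu> \<in> polar_set Q \<and> \<mu> \<bullet> F zb = 0}"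
    using zb_\<Theta> by simp
  then show ?thesis by (simp add: DF_zb F_zb)
qed

end

section \<open>The linearised system\<close>

locale variational_system =
  fixes f :: "'a::euclidean_space \<Rightarrow> 'a" and f' :: "'a \<Rightarrow> 'a"
    and \<Phi> :: "'a \<Rightarrow> 'b::euclidean_space"
    and D :: "'a \<Rightarrow> 'a \<Rightarrow>\<^sub>L 'b" and D2 :: "'a \<Rightarrow> 'a \<Rightarrow>\<^sub>L 'b"
    and \<Theta> :: "'b set" and xb :: 'a and lb :: 'b
  assumes f: "(f has_derivative f') (at xb)"
    and \<Phi>: "\<And>x. (\<Phi> has_derivative blinfun_apply (D x)) (at x)"
    and D: "(D has_derivative D2) (at xb)"
    and lb: "lb \<in> multipliers f \<Phi> \<Theta> xb"
begin

lemma Psi_eq: "Psi f \<Phi> x l = f x + adj (D x) l"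
  by (simp add: Psi_def adj_def frechet_derivative_at[OF \<Phi>, symmetric])

lemma Psi_lb: "Psi f \<Phi> xb lb = 0" and lb_normal: "lb \<in> normal_cone \<Theta> (\<Phi> xb)"
  using lb by (simp_all add: multipliers_def)

text \<open>Subtracting the equation for \<open>lb\<close> turns the one for \<open>l\<close> into a
  condition linear in \<open>l - lb\<close>.\<close>

lemma mem_multipliers: "l \<in> multipliers f \<Phi> \<Theta> xb \<longleftrightarrow>
    adj (D xb) l = adj (D xb) lb \<and> l \<in> normal_cone \<Theta> (\<Phi> xb)"
proof -
  have "f xb + adj (D xb) l = 0 \<longleftrightarrow> adj (D xb) l = adj (D xb) lb"
    using Psi_lb by (metis Psi_eq add_left_cancel)
  then show ?thesis by (simp add: multipliers_def Psi_eq)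
qed

text \<open>The partial derivative of \<open>Psi\<close> in \<open>x\<close> at
  \<open>(xb, lb)\<close>.\<close>

definition J :: "'a \<Rightarrow> 'a" where "J \<xi> = f' \<xi> + adj (D2 \<xi>) lb"

lemma J: "((\<lambda>x. Psi f \<Phi> x lb) has_derivative J) (at xb)"
  unfolding Psi_eq J_def
  by (intro has_derivative_add f bounded_linear.has_derivative[OF adj.bounded_linear_left D])

text \<open>Criticality with its witness made explicit: \<open>\<eta>\<close> is the element of the
  graphical derivative that solves the linearised equation for \<open>\<xi>\<close>.\<close>

definition critical_pair :: "'a \<Rightarrow> 'b \<Rightarrow> bool" where
  "critical_pair \<xi> \<eta> \<longleftrightarrow> J \<xi> + adj (D xb) \<eta> = 0 \<and>
     (blinfun_apply (D xb) \<xi>, \<eta>) \<in> tangent_cone (gph (normal_cone \<Theta>)) (\<Phi> xb, lb)"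

lemma noncritical_iff: "noncritical f \<Phi> \<Theta> xb lb \<longleftrightarrow> (\<forall>\<xi> \<eta>. critical_pair \<xi> \<eta> \<longrightarrow> \<xi> = 0)"
proof -
  \<comment> \<open>\<open>noncritical\<close> is an equivalence for each \<open>\<xi>\<close>, so
    \<open>\<xi> = 0\<close> has to be a solution; a constant sequence in the graph shows
    it.\<close>
  have "critical_pair 0 0"
    using lb_normal has_derivative_bounded_linear[OF J]
    by (auto simp: critical_pair_def adj.zero_right bounded_linear.linear linear_0 gph_def blinfun.zero_right
        intro!: tangent_cone_eventuallyI[OF _ LIMSEQ_Suc[OF lim_1_over_n] tendsto_const])
  moreover have "(0 \<in> {frechet_derivative (\<lambda>y. Psi f \<Phi> y lb) (at xb) \<xi>
        + adjoint (frechet_derivative \<Phi> (at xb)) \<eta> | \<eta>.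
          \<eta> \<in> graphical_derivative (normal_cone \<Theta>) (\<Phi> xb) lb (frechet_derivative \<Phi> (at xb) \<xi>)})
      \<longleftrightarrow> (\<exists>\<eta>. critical_pair \<xi> \<eta>)" for \<xi>
    by (force simp: critical_pair_def graphical_derivative_def adj_def
        frechet_derivative_at[OF J, symmetric] frechet_derivative_at[OF \<Phi>, symmetric])
  ultimately show ?thesis
    unfolding noncritical_def by blast
qed

text \<open>In \<open>Psi f \<Phi> x l = Psi f \<Phi> x lb + adj (D x) (l - lb)\<close>, the
  difference quotient of \<open>D\<close> meets the factor \<open>l n - lb\<close>, which tends to
  0. This factor has no rate relative to \<open>t n\<close>, so its term with \<open>D xb\<close>
  stays on the left.\<close>

lemma Psi_expansion:
  assumes t: "t \<longlonglongrightarrow> (0::real)" "\<And>n::nat. 0 < t n" and \<xi>: "\<xi> \<longlonglongrightarrow> x" and l: "l \<longlonglongrightarrow> lb"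
  shows "(\<lambda>n. Psi f \<Phi> (xb + t n *\<^sub>R \<xi> n) (l n) /\<^sub>R t n - adj (D xb) ((l n - lb) /\<^sub>R t n)) \<longlonglongrightarrow> J x"
proof -
  let ?x = "\<lambda>n. xb + t n *\<^sub>R \<xi> n"
  have "(\<lambda>n. (Psi f \<Phi> (?x n) lb - Psi f \<Phi> xb lb) /\<^sub>R t n
          + adj ((D (?x n) - D xb) /\<^sub>R t n) (l n - lb)) \<longlonglongrightarrow> J x + adj (D2 x) (lb - lb)"
    by (intro tendsto_add adj.tendsto tendsto_diff l tendsto_const
        has_derivative_sequentially[OF J t \<xi>] has_derivative_sequentially[OF D t \<xi>])
  moreover have "(Psi f \<Phi> (?x n) lb - Psi f \<Phi> xb lb) /\<^sub>R t n + adj ((D (?x n) - D xb) /\<^sub>R t n) (l n - lb)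
      = Psi f \<Phi> (?x n) (l n) /\<^sub>R t n - adj (D xb) ((l n - lb) /\<^sub>R t n)" for n
    by (simp add: Psi_lb) (simp add: Psi_eq adj.diff_left adj.diff_right adj.scaleR_left adj.scaleR_right algebra_simps)
  ultimately show ?thesis by (simp add: adj.zero_right)
qed

text \<open>Along a sequence realising a critical pair, \<open>x\<close> moves by
  \<open>t k *\<^sub>R \<xi>\<close> while both residuals are of smaller order than
  \<open>t k\<close>; the estimate divided by \<open>t k\<close> gives
  \<open>norm \<xi> \<le> 0\<close> in the limit.\<close>

lemma estimate_imp_noncritical:
  assumes e: "0 < e" and est: "\<And>x l w. norm (x - xb) < e \<Longrightarrow> norm (l - lb) < e \<Longrightarrow> norm w < e \<Longrightarrow>
      norm (Psi f \<Phi> x l) < e \<Longrightarrow> l \<in> normal_cone \<Theta> (\<Phi> x + w) \<Longrightarrow>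
      norm (x - xb) \<le> c * (norm (Psi f \<Phi> x l) + norm w)"
  shows "noncritical f \<Phi> \<Theta> xb lb"
  unfolding noncritical_iff
proof (intro allI impI)
  fix \<xi> \<eta> assume crit: "critical_pair \<xi> \<eta>"
  let ?u = "blinfun_apply (D xb) \<xi>"
  from crit have "(?u, \<eta>) \<in> tangent_cone (gph (normal_cone \<Theta>)) (\<Phi> xb, lb)"
    by (simp add: critical_pair_def)
  then obtain t ws where t: "\<And>k::nat. 0 < t k" "t \<longlonglongrightarrow> (0::real)" and ws: "ws \<longlonglongrightarrow> (?u, \<eta>)"
    and gph: "\<And>k. (\<Phi> xb, lb) + t k *\<^sub>R ws k \<in> gph (normal_cone \<Theta>)"
    by (rule tangent_coneE) blast
  define u \<zeta> where "u = (\<lambda>k. fst (ws k))" and "\<zeta> = (\<lambda>k. snd (ws k))"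
  have u: "u \<longlonglongrightarrow> ?u" and \<zeta>: "\<zeta> \<longlonglongrightarrow> \<eta>"
    using tendsto_fst[OF ws] tendsto_snd[OF ws] by (simp_all add: u_def \<zeta>_def)
  have gph: "lb + t k *\<^sub>R \<zeta> k \<in> normal_cone \<Theta> (\<Phi> xb + t k *\<^sub>R u k)" for k
    using gph[of k] by (auto simp: gph_def u_def \<zeta>_def plus_prod_def scaleR_prod_def)
  define x where "x k = xb + t k *\<^sub>R \<xi>" for k
  define l where "l k = lb + t k *\<^sub>R \<zeta> k" for k
  \<comment> \<open>This shift makes \<open>\<Phi> (x k) + w k\<close> the point at which
    \<open>lb + t k *\<^sub>R \<zeta> k\<close> is normal.\<close>
  define w where "w k = \<Phi> xb + t k *\<^sub>R u k - \<Phi> (x k)" for k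
  define v where "v k = Psi f \<Phi> (x k) (l k)" for k
  have tz: "(\<lambda>k. t k *\<^sub>R y k) \<longlonglongrightarrow> 0" if "y \<longlonglongrightarrow> y0" for y and y0 :: "'z::real_normed_vector"
    using tendsto_scaleR[OF t(2) that] by simp
  have l: "l \<longlonglongrightarrow> lb"
    unfolding l_def using tendsto_add[OF tendsto_const tz[OF \<zeta>]] by simp
  have "(\<lambda>k. u k - (\<Phi> (x k) - \<Phi> xb) /\<^sub>R t k) \<longlonglongrightarrow> ?u - ?u"
    unfolding x_def by (intro tendsto_diff u has_derivative_sequentially[OF \<Phi> t(2,1)] tendsto_const)
  moreover have "u k - (\<Phi> (x k) - \<Phi> xb) /\<^sub>R t k = w k /\<^sub>R t k" for k
    using t(1)[of k] by (simp add: w_def algebra_simps)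
  ultimately have w0: "(\<lambda>k. w k /\<^sub>R t k) \<longlonglongrightarrow> 0" by simp
  have "(\<lambda>k. (v k /\<^sub>R t k - adj (D xb) ((l k - lb) /\<^sub>R t k)) + adj (D xb) (\<zeta> k)) \<longlonglongrightarrow> J \<xi> + adj (D xb) \<eta>"
    unfolding v_def x_def by (intro tendsto_add Psi_expansion t l tendsto_const adj.tendsto \<zeta>)
  moreover have "(l k - lb) /\<^sub>R t k = \<zeta> k" for k
    using t(1)[of k] by (simp add: l_def)
  ultimately have v0: "(\<lambda>k. v k /\<^sub>R t k) \<longlonglongrightarrow> 0"
    using crit by (simp add: critical_pair_def)
  have small: "\<forall>\<^sub>F k in sequentially. norm (y k) < e" if "y \<longlonglongrightarrow> 0" for y :: "nat \<Rightarrow> 'z::real_normed_vector"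
    using order_tendstoD(2)[OF tendsto_norm_zero[OF that] e] .
  have "w \<longlonglongrightarrow> 0" "v \<longlonglongrightarrow> 0" "(\<lambda>k. x k - xb) \<longlonglongrightarrow> 0" "(\<lambda>k. l k - lb) \<longlonglongrightarrow> 0"
    using tz[OF w0] tz[OF v0] tz[OF tendsto_const[of \<xi>]] l t(1)[THEN less_imp_neq]
    by (simp_all add: x_def LIM_zero_iff)
  then have "\<forall>\<^sub>F k in sequentially. norm (w k) < e \<and> norm (v k) < e \<and> norm (x k - xb) < e \<and> norm (l k - lb) < e"
    by (intro eventually_conj small)
  then have "\<forall>\<^sub>F k in sequentially. norm \<xi> \<le> c * (norm (v k /\<^sub>R t k) + norm (w k /\<^sub>R t k))"
  proof eventually_elim
    case (elim k)
    have "l k \<in> normal_cone \<Theta> (\<Phi> (x k) + w k)" using gph[of k] by (simp add: l_def w_def)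
    with elim est[of "x k" "l k" "w k"] have "norm (x k - xb) \<le> c * (norm (v k) + norm (w k))"
      by (simp add: v_def)
    then show ?case
      using t(1)[of k] by (simp add: x_def field_simps)
  qed
  moreover have "(\<lambda>k. c * (norm (v k /\<^sub>R t k) + norm (w k /\<^sub>R t k))) \<longlonglongrightarrow> c * (norm (0::'a) + norm (0::'b))"
    by (intro tendsto_intros v0 w0)
  ultimately have "norm \<xi> \<le> c * (norm (0::'a) + norm (0::'b))"
    using tendsto_lowerbound sequentially_bot by blast
  then show "\<xi> = 0" by simp
qed

end

section \<open>Estimates from strict complementarity\<close>

locale reducible_system =
  variational_system f f' \<Phi> D D2 \<Theta> xb lb + straightened_set \<Theta> U Q F DF DDF "\<Phi> xb"
  for f :: "'a::euclidean_space \<Rightarrow> 'a" and f' :: "'a \<Rightarrow> 'a"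
    and \<Phi> :: "'a \<Rightarrow> 'b::euclidean_space" and D D2 and \<Theta> :: "'b set" and xb lb
    and U Q F DF DDF +
  fixes l0 :: 'b
  assumes l0: "l0 \<in> multipliers f \<Phi> \<Theta> xb" "l0 \<in> rel_interior (normal_cone \<Theta> (\<Phi> xb))"
begin

abbreviation A :: "'a \<Rightarrow>\<^sub>L 'b" where "A \<equiv> D xb"
abbreviation K :: "'b set" where "K \<equiv> polar_set Q"

section \<open>Strict complementarity and the cone \<open>K\<close>\<close>

lemma lb_K: "lb \<in> K" and l0_K: "l0 \<in> K" and A_l0: "adj A l0 = adj A lb"
  using lb l0(1) by (simp_all add: mem_multipliers normal_cone_zb)

lemma K_add: "\<mu> \<in> K \<Longrightarrow> \<nu> \<in> K \<Longrightarrow> \<mu> + \<nu> \<in> K"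
  using convex_polar cone_polar convex_cone[of K] by blast

lemma K_scale: "\<mu> \<in> K \<Longrightarrow> 0 \<le> s \<Longrightarrow> s *\<^sub>R \<mu> \<in> K"
  using cone_polar by (simp add: mem_cone)

text \<open>As \<open>K\<close> contains 0, its affine hull is its span; halving the radius of the
  open ball allows a non-strict bound.\<close>

lemma strict_complementarity_ball:
  obtains e where "0 < e" "\<And>\<sigma>. \<sigma> \<in> span K \<Longrightarrow> norm \<sigma> \<le> e \<Longrightarrow> l0 + \<sigma> \<in> K"
proof -
  have "affine hull K = span K"
    by (rule affine_hull_span_0) (rule hull_inc[OF zero_polar])
  then obtain e where e: "0 < e" "ball l0 e \<inter> span K \<subseteq> K"
    using l0(2) by (auto simp: normal_cone_zb mem_rel_interior_ball)
  show ?thesis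
  proof (rule that[of "e / 2"])
    fix \<sigma> assume "\<sigma> \<in> span K" "norm \<sigma> \<le> e / 2"
    then have "l0 + \<sigma> \<in> ball l0 e \<inter> span K"
      using e(1) l0_K by (simp add: dist_norm span_add span_base)
    with e(2) show "l0 + \<sigma> \<in> K" by blast
  qed (use e in simp)
qed

text \<open>The functional given by \<open>u\<close> is nonpositive on \<open>K\<close> and vanishes
  at the relative interior point \<open>l0\<close>; steps from \<open>l0\<close> along
  \<open>\<sigma>\<close> and \<open>- \<sigma>\<close> force it to vanish on
  \<open>\<sigma>\<close>.\<close>

lemma span_orthogonal:
  assumes u: "u \<in> Q" "u = blinfun_apply A \<xi>" "lb \<bullet> u = 0" and \<sigma>: "\<sigma> \<in> span K"
  shows "\<sigma> \<bullet> u = 0"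
proof (cases "\<sigma> = 0")
  case False
  obtain e where e: "0 < e" "\<And>\<sigma>. \<sigma> \<in> span K \<Longrightarrow> norm \<sigma> \<le> e \<Longrightarrow> l0 + \<sigma> \<in> K"
    by (rule strict_complementarity_ball) blast
  have "l0 \<bullet> u = lb \<bullet> u"
    using A_l0 u(2) by (metis adj_inner)
  then have l0u: "l0 \<bullet> u = 0" using u(3) by simp
  define s where "s = e / norm \<sigma>"
  have s: "0 < s" "norm (s *\<^sub>R \<sigma>) \<le> e" using e False by (auto simp: s_def)
  have "l0 + s *\<^sub>R \<sigma> \<in> K" "l0 + - (s *\<^sub>R \<sigma>) \<in> K"
    using s(2) by (simp_all only: e(2) span_scale span_neg \<sigma> norm_minus_cancel)
  then have "(l0 + s *\<^sub>R \<sigma>) \<bullet> u \<le> 0" "(l0 + - (s *\<^sub>R \<sigma>)) \<bullet> u \<le> 0"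
    using u(1) by (auto simp: polar_set_def)
  then have "s * (\<sigma> \<bullet> u) = 0"
    by (simp add: inner_add_left inner_diff_left l0u)
  then show ?thesis using s by simp
qed simp

text \<open>Strict complementarity absorbs a multiple of \<open>l0 - lb\<close>, which \<open>adj A\<close> annihilates, so that
  the tangent cone to \<open>K\<close> at \<open>lb\<close> has the same image under \<open>adj A\<close> as the whole span of \<open>K\<close>.\<close>

lemma radial_direction:
  assumes \<sigma>: "\<sigma> \<in> span K"
  obtains \<rho> \<tau> where "adj A \<rho> = adj A \<sigma>" "0 < \<tau>" "\<And>t. 0 \<le> t \<Longrightarrow> t \<le> \<tau> \<Longrightarrow> lb + t *\<^sub>R \<rho> \<in> K"
proof -
  obtain e where e: "0 < e" "\<And>\<sigma>. \<sigma> \<in> span K \<Longrightarrow> norm \<sigma> \<le> e \<Longrightarrow> l0 + \<sigma> \<in> K"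
    by (rule strict_complementarity_ball) blast
  \<comment> \<open>This \<open>s\<close> makes \<open>\<sigma> /\<^sub>R s\<close> short enough for
    \<open>l0 + \<sigma> /\<^sub>R s\<close> to lie in \<open>K\<close>, and the summand 1 keeps it
    positive when \<open>\<sigma> = 0\<close>. The ray from \<open>lb\<close> is then a convex
    combination of \<open>lb\<close> and that point, with weight \<open>t * s\<close>.\<close>
  define s where "s = norm \<sigma> / e + 1"
  have s: "0 < s" using e by (simp add: s_def add_nonneg_pos)
  have "norm \<sigma> \<le> e * s" using e by (simp add: s_def field_simps)
  then have mem: "l0 + \<sigma> /\<^sub>R s \<in> K"
    using s by (intro e(2) span_scale \<sigma>) (simp add: field_simps)
  show ?thesis
  proof (rule that[of "\<sigma> + s *\<^sub>R (l0 - lb)" "1 / s"])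
    show "adj A (\<sigma> + s *\<^sub>R (l0 - lb)) = adj A \<sigma>"
      by (simp add: adj.add_right adj.scaleR_right adj.diff_right A_l0)
    fix t :: real assume t: "0 \<le> t" "t \<le> 1 / s"
    have "(1 - t * s) *\<^sub>R lb + (t * s) *\<^sub>R (l0 + \<sigma> /\<^sub>R s) \<in> K"
      using t s by (intro K_add K_scale lb_K mem) (auto simp: field_simps)
    then show "lb + t *\<^sub>R (\<sigma> + s *\<^sub>R (l0 - lb)) \<in> K"
      using s by (simp add: algebra_simps mult.left_commute[of s t])
  qed (use s in simp)
qed

text \<open>The limit is the curvature term of \<open>\<Theta>\<close>: the part of the slope of the
  normals that comes from the turning of \<open>DF\<close> and not from the change of the
  multiplier.\<close>

lemma adj_DF_expansion:
  assumes t: "t \<longlonglongrightarrow> (0::real)" "\<And>n::nat. 0 < t n" and u: "u \<longlonglongrightarrow> u0" and m: "m \<longlonglongrightarrow> lb"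
  shows "(\<lambda>n. (adj (DF (\<Phi> xb + t n *\<^sub>R u n)) (m n) - lb) /\<^sub>R t n - (m n - lb) /\<^sub>R t n)
    \<longlonglongrightarrow> adj (DDF u0) lb"
proof -
  have "(\<lambda>n. adj ((DF (\<Phi> xb + t n *\<^sub>R u n) - DF (\<Phi> xb)) /\<^sub>R t n) (m n)) \<longlonglongrightarrow> adj (DDF u0) lb"
    by (intro adj.tendsto has_derivative_sequentially[OF DDF t u] m)
  then show ?thesis
    by (simp add: DF_zb adj.scaleR_left adj.diff_left flip: scaleR_diff_right)
qed

text \<open>Eventually \<open>F (z k) = t k *\<^sub>R u\<close>, while the multipliers are
  \<open>m k = lb + t k *\<^sub>R \<rho>\<close>. Complementarity holds because \<open>u\<close> is
  orthogonal to all of \<open>K\<close>. The resulting normals have slope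
  \<open>adj (DDF u) lb + \<rho>\<close>, whose image under \<open>adj A\<close> cancels
  \<open>J \<xi>\<close>.\<close>

lemma critical_pair_exists:
  assumes u: "u \<in> Q" "u = blinfun_apply A \<xi>" "lb \<bullet> u = 0"
    and range: "- J \<xi> - adj A (adj (DDF u) lb) \<in> adj A ` span K"
  shows "\<exists>\<eta>. critical_pair \<xi> \<eta>"
proof -
  obtain \<sigma> where \<sigma>: "\<sigma> \<in> span K" "- J \<xi> - adj A (adj (DDF u) lb) = adj A \<sigma>"
    using range by blast
  obtain \<rho> \<tau> where \<rho>: "adj A \<rho> = adj A \<sigma>" "0 < \<tau>"
    "\<And>t. 0 \<le> t \<Longrightarrow> t \<le> \<tau> \<Longrightarrow> lb + t *\<^sub>R \<rho> \<in> K"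
    by (rule radial_direction[OF \<sigma>(1)]) blast
  obtain r where r: "0 < r" "\<And>z. z \<in> \<Theta> \<inter> ball (\<Phi> xb) r \<Longrightarrow>
      F z \<in> Q \<and> normal_cone \<Theta> z = {adj (DF z) \<mu> |\<mu>. \<mu> \<in> K \<and> \<mu> \<bullet> F z = 0}"
    by (rule normal_cone_near) blast
  obtain W V g G where W: "open W" "W \<subseteq> U" "\<Phi> xb \<in> W" and V: "open V" "0 \<in> V"
    and hom: "homeomorphism W V F g"
    and G: "\<And>y. y \<in> V \<Longrightarrow> (g has_derivative G y) (at y)"
      "\<And>y. y \<in> V \<Longrightarrow> G y = inv (blinfun_apply (DF (g y)))"
    by (rule local_inverse) blast
  have g0: "g 0 = \<Phi> xb" using hom W(3) F_zb by (metis homeomorphism_apply1)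
  have "inv (blinfun_apply (DF (g 0))) = (\<lambda>y. y)"
    by (simp add: g0 DF_zb inv_equality)
  then have dg: "(g has_derivative (\<lambda>y. y)) (at 0)"
    using G[OF V(2)] by simp
  define t where "t k = 1 / real (Suc k)" for k
  have t: "t \<longlonglongrightarrow> 0" "\<And>k. 0 < t k"
    unfolding t_def using LIMSEQ_Suc[OF lim_1_over_n] by simp_all
  define z where "z k = g (t k *\<^sub>R u)" for k
  define un where "un = (\<lambda>k. (z k - \<Phi> xb) /\<^sub>R t k)"
  have zun: "z k = \<Phi> xb + t k *\<^sub>R un k" for k
    using t(2)[of k] by (simp add: un_def)
  have un: "un \<longlonglongrightarrow> u"
    using has_derivative_sequentially[OF dg t tendsto_const[of u]]
    by (simp add: un_def z_def g0)
  define m where "m k = lb + t k *\<^sub>R \<rho>" for k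
  have m: "m \<longlonglongrightarrow> lb"
    unfolding m_def using tendsto_add[OF tendsto_const tendsto_scaleR[OF t(1) tendsto_const]] by force
  define \<zeta> where "\<zeta> k = (adj (DF (z k)) (m k) - lb) /\<^sub>R t k" for k
  have "(\<lambda>k. (\<zeta> k - (m k - lb) /\<^sub>R t k) + \<rho>) \<longlonglongrightarrow> adj (DDF u) lb + \<rho>"
    unfolding \<zeta>_def zun by (intro tendsto_add adj_DF_expansion t un m tendsto_const)
  moreover have "(m k - lb) /\<^sub>R t k = \<rho>" for k
    using t(2)[of k] by (simp add: m_def)
  ultimately have \<zeta>: "\<zeta> \<longlonglongrightarrow> adj (DDF u) lb + \<rho>" by simp
  have "z \<longlonglongrightarrow> \<Phi> xb"
    unfolding zun using tendsto_add[OF tendsto_const tendsto_scaleR[OF t(1) un]] by force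
  then have "\<forall>\<^sub>F k in sequentially. z k \<in> ball (\<Phi> xb) r"
    by (rule topological_tendstoD) (use r(1) in auto)
  moreover have "(\<lambda>k. t k *\<^sub>R u) \<longlonglongrightarrow> 0"
    using tendsto_scaleR[OF t(1) tendsto_const[of u]] by simp
  then have "\<forall>\<^sub>F k in sequentially. t k *\<^sub>R u \<in> V"
    by (rule topological_tendstoD[OF _ V])
  moreover have "\<forall>\<^sub>F k in sequentially. t k < \<tau>"
    using t(1) \<rho>(2) by (rule order_tendstoD)
  ultimately have "\<forall>\<^sub>F k in sequentially. (\<Phi> xb, lb) + t k *\<^sub>R (un k, \<zeta> k) \<in> gph (normal_cone \<Theta>)"
  proof eventually_elim
    case (elim k)
    have zW: "z k \<in> W" and Fz: "F (z k) = t k *\<^sub>R u"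
      using hom elim(2) by (auto simp: z_def homeomorphism_def)
    then have "z k \<in> \<Theta>"
      using W(2) mem_\<Theta>_iff u(1) cone_Q t(2)[of k] by (simp add: subset_iff mem_cone)
    have mK: "m k \<in> K"
      unfolding m_def using elim(3) t(2)[of k] by (intro \<rho>(3)) auto
    then have "m k \<bullet> u = 0"
      by (intro span_orthogonal[OF u] span_base)
    then have "adj (DF (z k)) (m k) \<in> normal_cone \<Theta> (z k)"
      using r(2)[of "z k"] elim(1) \<open>z k \<in> \<Theta>\<close> mK Fz by auto
    moreover have "adj (DF (z k)) (m k) = lb + t k *\<^sub>R \<zeta> k"
      using t(2)[of k] by (simp add: \<zeta>_def)
    ultimately show ?case
      by (simp add: gph_def zun)
  qed
  from tangent_cone_eventuallyI[OF t(2,1) tendsto_Pair[OF un \<zeta>] this]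
  have "critical_pair \<xi> (adj (DDF u) lb + \<rho>)"
    using \<sigma>(2) \<rho>(1) u(2) by (simp add: critical_pair_def adj.add_right algebra_simps flip: \<sigma>(2))
  then show ?thesis by blast
qed

text \<open>A linear image of a closed cone need not be closed, but that of a subspace is; this is
  the gain from passing to the span of \<open>K\<close>.\<close>

lemma closed_range_span: "closed (adj A ` span K)"
  by (intro closed_subspace linear_subspace_image subspace_span)
    (simp add: adj.bounded_linear_right bounded_linear.linear)

lemma K_diff_range:
  assumes "\<mu> \<in> K"
  shows "adj A ((\<mu> - lb) /\<^sub>R s) \<in> adj A ` span K"
  using assms lb_K by (intro imageI span_scale span_diff span_base)

text \<open>Blow-up: if no radius and constant serve, there are points whose residuals are of
  smaller order than \<open>norm (x - xb)\<close>; their normalised displacements have a unit limit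
  \<open>\<xi>\<close>, to which \<open>critical_pair_exists\<close> applies.\<close>

lemma noncritical_imp_primal_estimate:
  assumes nc: "noncritical f \<Phi> \<Theta> xb lb"
  obtains e c where "0 < e" "0 \<le> c"
    "\<And>x l w. norm (x - xb) < e \<Longrightarrow> norm (l - lb) < e \<Longrightarrow> norm w < e \<Longrightarrow>
      l \<in> normal_cone \<Theta> (\<Phi> x + w) \<Longrightarrow> norm (x - xb) \<le> c * (norm (Psi f \<Phi> x l) + norm w)"
proof (rule ccontr)
  assume not_est: "\<not> thesis"
  obtain r where r: "0 < r" "\<And>z. z \<in> ball (\<Phi> xb) r \<Longrightarrow> norm (DF z - id_blinfun) \<le> 1/2"
    "\<And>z. z \<in> \<Theta> \<inter> ball (\<Phi> xb) r \<Longrightarrow>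
      F z \<in> Q \<and> normal_cone \<Theta> z = {adj (DF z) \<mu> |\<mu>. \<mu> \<in> K \<and> \<mu> \<bullet> F z = 0}"
    by (rule normal_cone_near) blast
  have "isCont \<Phi> xb" using \<Phi> by (rule has_derivative_continuous)
  then obtain \<delta> where \<delta>: "0 < \<delta>" "\<And>x. dist x xb < \<delta> \<Longrightarrow> dist (\<Phi> x) (\<Phi> xb) < r / 2"
    using r(1) unfolding continuous_at_eps_delta by (metis half_gt_zero)
  \<comment> \<open>The first entry drives the sequence to \<open>(xb, lb)\<close>; the others keep
    \<open>\<Phi> x + w\<close> in the ball where the formula for normals holds.\<close>
  define e where "e n = min (1 / real (Suc n)) (min \<delta> (r / 2))" for n
  have e: "0 < e n" for n using \<delta>(1) r(1) by (simp add: e_def)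
  have "\<exists>x l w. norm (x - xb) < e n \<and> norm (l - lb) < e n \<and> norm w < e n \<and>
      l \<in> normal_cone \<Theta> (\<Phi> x + w) \<and> real (Suc n) * (norm (Psi f \<Phi> x l) + norm w) < norm (x - xb)" for n
  proof (rule ccontr)
    assume "\<not> ?thesis"
    then have "norm (x - xb) \<le> real (Suc n) * (norm (Psi f \<Phi> x l) + norm w)"
      if "norm (x - xb) < e n" "norm (l - lb) < e n" "norm w < e n" "l \<in> normal_cone \<Theta> (\<Phi> x + w)" for x l w
      using that by (meson not_less)
    then show False using not_est that[of "e n" "real (Suc n)"] e by (metis of_nat_0_le_iff)
  qed
  then obtain x' l' w' where seq: "\<And>n. norm (x' n - xb) < e n" "\<And>n. norm (l' n - lb) < e n"
    "\<And>n. norm (w' n) < e n" "\<And>n. l' n \<in> normal_cone \<Theta> (\<Phi> (x' n) + w' n)"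
    "\<And>n. real (Suc n) * (norm (Psi f \<Phi> (x' n) (l' n)) + norm (w' n)) < norm (x' n - xb)"
    by metis
  \<comment> \<open>The strict violation excludes \<open>x' n = xb\<close>, so the displacement can
    be normalised.\<close>
  have pos: "0 < norm (x' n - xb)" for n
    using seq(5)[of n] by (meson add_nonneg_nonneg le_less_trans mult_nonneg_nonneg norm_ge_zero of_nat_0_le_iff)
  have "\<forall>n. (x' n - xb) /\<^sub>R norm (x' n - xb) \<in> sphere 0 1"
    using pos by (simp add: less_imp_neq)
  then obtain \<xi> \<phi> where \<xi>: "\<xi> \<in> sphere 0 1" and \<phi>: "strict_mono \<phi>"
    and lim\<xi>: "((\<lambda>n. (x' n - xb) /\<^sub>R norm (x' n - xb)) \<circ> \<phi>) \<longlonglongrightarrow> \<xi>"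
    using compact_sphere[of "0::'a" 1] unfolding compact_def by meson
  define x l w where "x = x' \<circ> \<phi>" and "l = l' \<circ> \<phi>" and "w = w' \<circ> \<phi>"
  define t where "t = (\<lambda>n. norm (x n - xb))"
  define \<xi>n where "\<xi>n = (\<lambda>n. (x n - xb) /\<^sub>R t n)"
  define v where "v = (\<lambda>n. Psi f \<Phi> (x n) (l n))"
  have \<xi>n: "\<xi>n \<longlonglongrightarrow> \<xi>" using lim\<xi> by (simp add: \<xi>n_def t_def x_def comp_def)
  have t_pos: "0 < t n" for n using pos by (simp add: t_def x_def)
  have x_eq: "x n = xb + t n *\<^sub>R \<xi>n n" for n using t_pos[of n] by (simp add: \<xi>n_def)
  have inv0: "(\<lambda>n. 1 / real (Suc n)) \<longlonglongrightarrow> 0" using LIMSEQ_Suc[OF lim_1_over_n] .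
  have e_le: "e (\<phi> n) \<le> 1 / real (Suc n)" for n
  proof -
    have "n \<le> \<phi> n" using \<phi> by (rule strict_mono_imp_increasing)
    then have "1 / real (Suc (\<phi> n)) \<le> 1 / real (Suc n)" by (simp add: frac_le)
    then show ?thesis unfolding e_def by linarith
  qed
  have t: "t \<longlonglongrightarrow> 0"
  proof (rule Lim_null_comparison[OF always_eventually inv0], rule allI)
    show "norm (t n) \<le> 1 / real (Suc n)" for n
      using seq(1)[of "\<phi> n"] e_le[of n] by (simp add: t_def x_def)
  qed
  have "(\<lambda>n. l n - lb) \<longlonglongrightarrow> 0"
  proof (rule Lim_null_comparison[OF always_eventually inv0], rule allI)
    show "norm (l n - lb) \<le> 1 / real (Suc n)" for n
      using seq(2)[of "\<phi> n"] e_le[of n] by (simp add: l_def)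
  qed
  then have l: "l \<longlonglongrightarrow> lb" by (simp add: LIM_zero_iff)
  have vw: "norm (v n) + norm (w n) \<le> t n * (1 / real (Suc n))" for n
  proof -
    have "n \<le> \<phi> n" using \<phi> by (rule strict_mono_imp_increasing)
    then have "real (Suc n) * (norm (v n) + norm (w n)) \<le> real (Suc (\<phi> n)) * (norm (v n) + norm (w n))"
      by (intro mult_right_mono) auto
    also have "\<dots> \<le> t n"
      using seq(5)[of "\<phi> n"] by (simp add: v_def w_def t_def x_def l_def)
    finally show ?thesis by (simp add: field_simps)
  qed
  have v: "(\<lambda>n. v n /\<^sub>R t n) \<longlonglongrightarrow> 0"
  proof (rule Lim_null_comparison[OF always_eventually inv0], rule allI)
    fix n
    have "norm (v n) \<le> t n * (1 / real (Suc n))" using vw[of n] norm_ge_zero[of "w n"] by linarith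
    then show "norm (v n /\<^sub>R t n) \<le> 1 / real (Suc n)" using t_pos[of n] by (simp add: field_simps)
  qed
  have w: "(\<lambda>n. w n /\<^sub>R t n) \<longlonglongrightarrow> 0"
  proof (rule Lim_null_comparison[OF always_eventually inv0], rule allI)
    fix n
    have "norm (w n) \<le> t n * (1 / real (Suc n))" using vw[of n] norm_ge_zero[of "v n"] by linarith
    then show "norm (w n /\<^sub>R t n) \<le> 1 / real (Suc n)" using t_pos[of n] by (simp add: field_simps)
  qed
  define u where "u = blinfun_apply A \<xi>"
  define z where "z = (\<lambda>n. \<Phi> (x n) + w n)"
  define un where "un = (\<lambda>n. (\<Phi> (x n) - \<Phi> xb) /\<^sub>R t n + w n /\<^sub>R t n)"
  have z_eq: "z n = \<Phi> xb + t n *\<^sub>R un n" for n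
    using t_pos[of n] by (simp add: z_def un_def algebra_simps)
  have "un \<longlonglongrightarrow> u + 0"
    unfolding un_def u_def x_eq by (intro tendsto_add w has_derivative_sequentially[OF \<Phi> t t_pos \<xi>n])
  then have un: "un \<longlonglongrightarrow> u" by simp
  have zlim: "z \<longlonglongrightarrow> \<Phi> xb"
    unfolding z_eq using tendsto_add[OF tendsto_const tendsto_scaleR[OF t un]] by force
  have l_normal: "l n \<in> normal_cone \<Theta> (z n)" for n
    using seq(4) by (simp add: l_def z_def x_def w_def)
  have z_ball: "z n \<in> ball (\<Phi> xb) r" for n
  proof -
    have "dist (x n) xb < \<delta>" "norm (w n) < r / 2"
      using seq(1,3)[of "\<phi> n"] by (auto simp: x_def w_def dist_norm e_def)
    with \<delta>(2) have "norm (\<Phi> (x n) - \<Phi> xb) < r / 2" by (simp add: dist_norm)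
    with \<open>norm (w n) < r / 2\<close> show ?thesis
      using norm_triangle_ineq[of "\<Phi> (x n) - \<Phi> xb" "w n"]
      by (simp add: z_def dist_norm norm_minus_commute algebra_simps)
  qed
  have "z n \<in> \<Theta> \<inter> ball (\<Phi> xb) r" for n
    using l_normal[of n] z_ball[of n] by (auto simp: normal_cone_def split: if_splits)
  note zr = r(3)[OF this]
  have "\<forall>n. \<exists>m. m \<in> K \<and> m \<bullet> F (z n) = 0 \<and> l n = adj (DF (z n)) m"
    using l_normal zr by blast
  then obtain m where m: "\<And>n. m n \<in> K" "\<And>n. m n \<bullet> F (z n) = 0" "\<And>n. l n = adj (DF (z n)) (m n)"
    by metis
  have "(\<lambda>n. adj (DF (z n)) (m n)) \<longlonglongrightarrow> adj (DF (\<Phi> xb)) lb"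
    using l by (simp add: DF_zb flip: m(3))
  moreover have "(\<lambda>n. DF (z n)) \<longlonglongrightarrow> DF (\<Phi> xb)"
    using has_derivative_continuous[OF DDF] zlim by (rule isCont_tendsto_compose)
  ultimately have mlim: "m \<longlonglongrightarrow> lb"
    using r(2)[OF z_ball] by (rule adj_tendsto_cancel)
  have "(\<lambda>n. (F (z n) - F (\<Phi> xb)) /\<^sub>R t n) \<longlonglongrightarrow> blinfun_apply (DF (\<Phi> xb)) u"
    unfolding z_eq by (rule has_derivative_sequentially[OF DF t t_pos un])
  then have Flim: "(\<lambda>n. F (z n) /\<^sub>R t n) \<longlonglongrightarrow> u" by (simp add: F_zb DF_zb)
  have "F (z n) /\<^sub>R t n \<in> Q" for n
    using zr[of n] t_pos[of n] cone_Q by (simp add: mem_cone)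
  then have uQ: "u \<in> Q" using closed_sequentially[OF closed_Q _ Flim] by blast
  have "(\<lambda>n. m n \<bullet> (F (z n) /\<^sub>R t n)) \<longlonglongrightarrow> lb \<bullet> u"
    by (intro tendsto_inner mlim Flim)
  then have lbu: "lb \<bullet> u = 0" by (simp add: m(2) LIMSEQ_const_iff)
  \<comment> \<open>Neither \<open>(l n - lb) /\<^sub>R t n\<close> nor
    \<open>(m n - lb) /\<^sub>R t n\<close> need converge; the combinations in the two expansions
    do, and together they leave the image of the latter under \<open>adj A\<close>.\<close>
  have "(\<lambda>n. v n /\<^sub>R t n - (v n /\<^sub>R t n - adj A ((l n - lb) /\<^sub>R t n))
        - adj A ((l n - lb) /\<^sub>R t n - (m n - lb) /\<^sub>R t n)) \<longlonglongrightarrow> 0 - J \<xi> - adj A (adj (DDF u) lb)"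
  proof (intro tendsto_diff v adj.tendsto tendsto_const)
    show "(\<lambda>n. v n /\<^sub>R t n - adj A ((l n - lb) /\<^sub>R t n)) \<longlonglongrightarrow> J \<xi>"
      unfolding v_def x_eq by (rule Psi_expansion[OF t t_pos \<xi>n l])
    show "(\<lambda>n. (l n - lb) /\<^sub>R t n - (m n - lb) /\<^sub>R t n) \<longlonglongrightarrow> adj (DDF u) lb"
      unfolding m(3) z_eq by (rule adj_DF_expansion[OF t t_pos un mlim])
  qed
  then have "(\<lambda>n. adj A ((m n - lb) /\<^sub>R t n)) \<longlonglongrightarrow> - J \<xi> - adj A (adj (DDF u) lb)"
    by (simp add: adj.diff_right)
  from closed_sequentially[OF closed_range_span _ this]
  have "- J \<xi> - adj A (adj (DDF u) lb) \<in> adj A ` span K"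
    using K_diff_range[OF m(1)] by blast
  from critical_pair_exists[OF uQ u_def lbu this] nc have "\<xi> = 0"
    unfolding noncritical_iff by blast
  with \<xi> show False by simp
qed

text \<open>A Slater-type argument: \<open>\<mu> + \<sigma>\<close> solves the linear equation but
  may leave \<open>K\<close>, and a convex combination with \<open>l0\<close>, a solution in the
  relative interior, brings it back at a cost of order \<open>norm \<sigma>\<close>. The bound
  \<open>R\<close> limits the distance from \<open>\<mu>\<close> to \<open>l0\<close>.\<close>

lemma multiplier_calmness:
  assumes "0 \<le> R"
  obtains \<kappa> where "0 \<le> \<kappa>" "\<And>\<mu>. \<mu> \<in> K \<Longrightarrow> norm \<mu> \<le> R \<Longrightarrow>
    \<exists>\<mu>'\<in>multipliers f \<Phi> \<Theta> xb. norm (\<mu> - \<mu>') \<le> \<kappa> * norm (adj A (\<mu> - lb))"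
proof -
  obtain h where h: "0 < h" "\<And>\<sigma>. \<sigma> \<in> span K \<Longrightarrow> norm \<sigma> \<le> h \<Longrightarrow> l0 + \<sigma> \<in> K"
    by (rule strict_complementarity_ball) blast
  have "linear (adj A)" by (simp add: adj.bounded_linear_right bounded_linear.linear)
  from linear_exists_right_inverse_on[OF this subspace_span[of K]]
  obtain k where k: "range k \<subseteq> span K" "linear k" "\<And>v. v \<in> adj A ` span K \<Longrightarrow> adj A (k v) = v"
    by blast
  obtain B where B: "0 \<le> B" "\<And>y. norm (k y) \<le> norm y * B"
    using bounded_linear.nonneg_bounded[of k] k(2) linear_conv_bounded_linear by blast
  define \<kappa> where "\<kappa> = B * (1 + (norm l0 + R) / h)"
  show ?thesis
  proof (rule that)
    show "0 \<le> \<kappa>" using B(1) h(1) assms by (simp add: \<kappa>_def)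
    fix \<mu> assume \<mu>: "\<mu> \<in> K" "norm \<mu> \<le> R"
    define \<sigma> where "\<sigma> = - k (adj A (\<mu> - lb))"
    have \<sigma>: "\<sigma> \<in> span K" using k(1) by (auto simp: \<sigma>_def intro: span_neg)
    have "adj A (\<mu> - lb) \<in> adj A ` span K" using K_diff_range[OF \<mu>(1), of 1] by simp
    then have A\<sigma>: "adj A \<sigma> = adj A lb - adj A \<mu>" by (simp add: \<sigma>_def adj.minus_right k(3) adj.diff_right)
    have n\<sigma>: "norm \<sigma> \<le> B * norm (adj A (\<mu> - lb))"
      using B(2)[of "adj A (\<mu> - lb)"] by (simp add: \<sigma>_def mult.commute)
    \<comment> \<open>For nonzero \<open>\<sigma>\<close>, this weight makes
      \<open>(1 - s) *\<^sub>R \<sigma> + s *\<^sub>R l0\<close> equal to \<open>s\<close> times the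
      sum of \<open>l0\<close> and a multiple of \<open>\<sigma>\<close> of norm exactly
      \<open>h\<close>, hence an element of \<open>K\<close>.\<close>
    define s where "s = norm \<sigma> / (h + norm \<sigma>)"
    have s: "0 \<le> s" "s \<le> 1"
      using h(1) by (simp_all add: s_def add_pos_nonneg)
    have s_le: "s \<le> norm \<sigma> / h"
      unfolding s_def using h(1) by (intro divide_left_mono) (simp_all add: add_pos_nonneg)
    have pert: "(1 - s) *\<^sub>R \<sigma> + s *\<^sub>R l0 \<in> K"
    proof (cases "\<sigma> = 0")
      case True
      then show ?thesis by (simp add: s_def zero_polar)
    next
      case False
      have s1: "1 - s = s * (h / norm \<sigma>)"
      proof -
        have "h + norm \<sigma> \<noteq> 0" using h(1) norm_ge_zero[of \<sigma>] by linarith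
        then show ?thesis using False by (simp add: s_def field_simps)
      qed
      have "s *\<^sub>R (l0 + (h / norm \<sigma>) *\<^sub>R \<sigma>) \<in> K"
        by (intro K_scale h(2) span_scale \<sigma> s) (use False h(1) in auto)
      then show ?thesis unfolding s1 by (simp add: algebra_simps)
    qed
    define \<mu>' where "\<mu>' = (1 - s) *\<^sub>R \<mu> + ((1 - s) *\<^sub>R \<sigma> + s *\<^sub>R l0)"
    have "\<mu>' \<in> K"
      unfolding \<mu>'_def using s by (intro K_add K_scale \<mu> pert) auto
    moreover have "adj A \<mu>' = adj A lb"
      unfolding \<mu>'_def adj.add_right adj.scaleR_right A\<sigma> A_l0 by (simp add: algebra_simps)
    ultimately have "\<mu>' \<in> multipliers f \<Phi> \<Theta> xb"
      by (simp add: mem_multipliers normal_cone_zb)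
    moreover have "norm (\<mu> - \<mu>') \<le> \<kappa> * norm (adj A (\<mu> - lb))"
    proof -
      have "\<mu> - \<mu>' = - ((1 - s) *\<^sub>R \<sigma>) + s *\<^sub>R (\<mu> - l0)"
        by (simp add: \<mu>'_def algebra_simps)
      then have "norm (\<mu> - \<mu>') \<le> (1 - s) * norm \<sigma> + s * norm (\<mu> - l0)"
        using norm_triangle_ineq[of "- ((1 - s) *\<^sub>R \<sigma>)" "s *\<^sub>R (\<mu> - l0)"] s by simp
      also have "\<dots> \<le> 1 * norm \<sigma> + norm \<sigma> / h * (norm l0 + R)"
        using s s_le h(1) \<mu>(2) norm_triangle_ineq4[of \<mu> l0]
        by (intro add_mono mult_mono) auto
      also have "\<dots> = norm \<sigma> * (1 + (norm l0 + R) / h)"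
        by (simp add: algebra_simps)
      also have "\<dots> \<le> (B * norm (adj A (\<mu> - lb))) * (1 + (norm l0 + R) / h)"
        using h(1) assms by (intro mult_right_mono n\<sigma>) simp
      finally show ?thesis by (simp add: \<kappa>_def mult_ac)
    qed
    ultimately show "\<exists>\<mu>'\<in>multipliers f \<Phi> \<Theta> xb. norm (\<mu> - \<mu>') \<le> \<kappa> * norm (adj A (\<mu> - lb))"
      by blast
  qed
qed

text \<open>With \<open>z = \<Phi> x + w\<close> and \<open>l = adj (DF z) \<mu>\<close> for some
  \<open>\<mu>\<close> in \<open>K\<close>, both \<open>l - \<mu>\<close> and
  \<open>adj A (\<mu> - lb)\<close> are of the order of \<open>norm (x - xb)\<close> plus the
  residuals. Then \<open>multiplier_calmness\<close> yields \<open>l'\<close>, and the primal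
  estimate removes \<open>norm (x - xb)\<close>.\<close>

lemma noncritical_imp_estimate:
  assumes nc: "noncritical f \<Phi> \<Theta> xb lb"
  obtains e c where "0 < e" "0 \<le> c"
    "\<And>x l w. norm (x - xb) < e \<Longrightarrow> norm (l - lb) < e \<Longrightarrow> norm w < e \<Longrightarrow>
      l \<in> normal_cone \<Theta> (\<Phi> x + w) \<Longrightarrow>
      \<exists>l'\<in>multipliers f \<Phi> \<Theta> xb. norm (x - xb) + norm (l - l') \<le> c * (norm (Psi f \<Phi> x l) + norm w)"
proof -
  obtain e1 c1 where e1: "0 < e1" "0 \<le> c1" "\<And>x l w. norm (x - xb) < e1 \<Longrightarrow> norm (l - lb) < e1 \<Longrightarrow>
      norm w < e1 \<Longrightarrow> l \<in> normal_cone \<Theta> (\<Phi> x + w) \<Longrightarrow>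
      norm (x - xb) \<le> c1 * (norm (Psi f \<Phi> x l) + norm w)"
    using noncritical_imp_primal_estimate[OF nc] by blast
  obtain r where r: "0 < r" "\<And>z. z \<in> ball (\<Phi> xb) r \<Longrightarrow> norm (DF z - id_blinfun) \<le> 1/2"
    "\<And>z. z \<in> \<Theta> \<inter> ball (\<Phi> xb) r \<Longrightarrow>
      F z \<in> Q \<and> normal_cone \<Theta> z = {adj (DF z) \<mu> |\<mu>. \<mu> \<in> K \<and> \<mu> \<bullet> F z = 0}"
    by (rule normal_cone_near) blast
  \<comment> \<open>Since \<open>e\<close> will be at most 1, \<open>M\<close> bounds
    \<open>norm l\<close>, and by \<open>near_identity_bounds\<close> the norm of
    \<open>\<mu>\<close> is at most \<open>2 * M\<close>.\<close>
  define M where "M = norm lb + 1"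
  have M: "0 \<le> M" by (simp add: M_def)
  obtain cf df where f_calm: "0 \<le> cf" "0 < df" "\<And>x. norm (x - xb) < df \<Longrightarrow> norm (f x - f xb) \<le> cf * norm (x - xb)"
    by (rule has_derivative_calm[OF f]) blast
  obtain cP dP where \<Phi>_calm: "0 \<le> cP" "0 < dP"
    "\<And>x. norm (x - xb) < dP \<Longrightarrow> norm (\<Phi> x - \<Phi> xb) \<le> cP * norm (x - xb)"
    by (rule has_derivative_calm[OF \<Phi>[of xb]]) blast
  obtain cD dD where D_calm: "0 \<le> cD" "0 < dD" "\<And>x. norm (x - xb) < dD \<Longrightarrow> norm (D x - A) \<le> cD * norm (x - xb)"
    by (rule has_derivative_calm[OF D]) blast
  obtain cF dF where DF_calm: "0 \<le> cF" "0 < dF"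
    "\<And>z. norm (z - \<Phi> xb) < dF \<Longrightarrow> norm (DF z - id_blinfun) \<le> cF * norm (z - \<Phi> xb)"
    using has_derivative_calm[OF DDF] unfolding DF_zb by metis
  obtain \<kappa> where \<kappa>: "0 \<le> \<kappa>" "\<And>\<mu>. \<mu> \<in> K \<Longrightarrow> norm \<mu> \<le> 2 * M \<Longrightarrow>
    \<exists>\<mu>'\<in>multipliers f \<Phi> \<Theta> xb. norm (\<mu> - \<mu>') \<le> \<kappa> * norm (adj A (\<mu> - lb))"
    by (rule multiplier_calmness[of "2 * M"]) (use M in auto)
  \<comment> \<open>If \<open>x - xb\<close> and \<open>w\<close> have norm below
    \<open>\<rho> / 2\<close>, calmness of \<open>\<Phi>\<close> puts \<open>z\<close> within
    \<open>min r dF\<close> of \<open>\<Phi> xb\<close>.\<close>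
  define \<rho> where "\<rho> = min r dF / (cP + 1)"
  have \<rho>: "0 < \<rho>" using r(1) DF_calm(2) \<Phi>_calm(1) by (simp add: \<rho>_def)
  define e where "e = Min {e1, df, dP, dD, \<rho> / 2, 1}"
  have e: "0 < e" "e \<le> e1" "e \<le> df" "e \<le> dP" "e \<le> dD" "e \<le> \<rho> / 2" "e \<le> 1"
    using e1(1) f_calm(2) \<Phi>_calm(2) D_calm(2) \<rho> by (auto simp: e_def)
  define c2 where "c2 = cF * (cP + 1) * (2 * M)"
  define c3 where "c3 = 1 + cf + cD * M + norm A * c2"
  have c2: "0 \<le> c2" using DF_calm(1) \<Phi>_calm(1) M by (simp add: c2_def)
  have c3: "0 \<le> c3" using f_calm(1) D_calm(1) M c2 by (simp add: c3_def)
  define c where "c = c1 + (c2 + \<kappa> * c3) * (1 + c1)"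
  show ?thesis
  proof (rule that[OF e(1)])
    show "0 \<le> c" using e1(2) c2 c3 \<kappa>(1) by (simp add: c_def)
    fix x l w assume x: "norm (x - xb) < e" and l: "norm (l - lb) < e" and w: "norm w < e"
      and ln: "l \<in> normal_cone \<Theta> (\<Phi> x + w)"
    define v where "v = Psi f \<Phi> x l"
    define q where "q = norm v + norm w"
    define s where "s = norm (x - xb) + q"
    have q: "0 \<le> q" "norm w \<le> q" "norm v \<le> q" by (simp_all add: q_def)
    have s: "0 \<le> s" "norm (x - xb) \<le> s" "q \<le> s" using q(1) by (simp_all add: s_def)
    have primal: "norm (x - xb) \<le> c1 * q"
      using e1(3)[of x l w] x l w ln e by (simp add: q_def v_def)
    have nl: "norm l \<le> M"
      using norm_triangle_ineq[of "l - lb" lb] l e(7) by (simp add: M_def)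
    define z where "z = \<Phi> x + w"
    have z1: "norm (z - \<Phi> xb) \<le> cP * norm (x - xb) + norm w"
      using \<Phi>_calm(3)[of x] x e norm_triangle_ineq[of "\<Phi> x - \<Phi> xb" w]
      by (simp add: z_def algebra_simps)
    have z2: "norm (z - \<Phi> xb) \<le> (cP + 1) * s"
    proof -
      have "cP * norm (x - xb) \<le> cP * s" using \<Phi>_calm(1) s by (intro mult_left_mono) auto
      with z1 q s show ?thesis by (simp add: algebra_simps)
    qed
    have "norm (z - \<Phi> xb) < (cP + 1) * \<rho>"
    proof -
      have "cP * norm (x - xb) \<le> cP * \<rho>" using \<Phi>_calm(1) x e(6) \<rho> by (intro mult_left_mono) auto
      with z1 w e(6) \<rho> show ?thesis by (simp add: algebra_simps)
    qed
    moreover have "(cP + 1) * \<rho> = min r dF" using \<Phi>_calm(1) by (simp add: \<rho>_def)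
    ultimately have z_near: "norm (z - \<Phi> xb) < r" "norm (z - \<Phi> xb) < dF" by simp_all
    then have z_ball: "z \<in> ball (\<Phi> xb) r" by (simp add: dist_norm norm_minus_commute)
    moreover have "z \<in> \<Theta>" using ln by (auto simp: z_def normal_cone_def split: if_splits)
    ultimately have "\<exists>\<mu>. \<mu> \<in> K \<and> l = adj (DF z) \<mu>"
      using r(3)[of z] ln unfolding z_def by blast
    then obtain \<mu> where \<mu>: "\<mu> \<in> K" "l = adj (DF z) \<mu>" by blast
    have n\<mu>: "norm \<mu> \<le> 2 * M"
      using near_identity_bounds(1)[OF r(2)[OF z_ball], of \<mu>] nl \<mu>(2) by simp
    have l\<mu>: "norm (l - \<mu>) \<le> c2 * s"
    proof -
      have "norm (l - \<mu>) \<le> norm (DF z - id_blinfun) * norm \<mu>"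
        using norm_adj_le[of "DF z - id_blinfun" \<mu>] by (simp add: adj.diff_left \<mu>(2))
      also have "\<dots> \<le> (cF * ((cP + 1) * s)) * (2 * M)"
        using DF_calm(3)[OF z_near(2)] mult_left_mono[OF z2 DF_calm(1)] n\<mu> s \<Phi>_calm(1) DF_calm(1)
        by (intro mult_mono) auto
      finally show ?thesis by (simp add: c2_def mult_ac)
    qed
    have A\<mu>: "norm (adj A (\<mu> - lb)) \<le> c3 * s"
    proof -
      \<comment> \<open>Subtract \<open>Psi f \<Phi> xb lb = 0\<close> from
        \<open>Psi f \<Phi> x l = v\<close>, then trade \<open>D x\<close> for \<open>A\<close> and
        \<open>l\<close> for \<open>\<mu>\<close>; every term is of order \<open>s\<close>.\<close>
      have "adj A (\<mu> - lb) = v - (f x - f xb) - adj (D x - A) l - adj A (l - \<mu>)"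
        using Psi_lb by (simp add: v_def Psi_eq adj.diff_left adj.diff_right algebra_simps eq_neg_iff_add_eq_0)
      also have "norm \<dots> \<le> norm v + norm (f x - f xb) + norm (adj (D x - A) l) + norm (adj A (l - \<mu>))"
        by (intro order_trans[OF norm_triangle_ineq4] add_mono order_refl)
      also have "\<dots> \<le> s + cf * s + cD * s * M + norm A * (c2 * s)"
      proof (intro add_mono)
        show "norm v \<le> s" using q s by linarith
        show "norm (f x - f xb) \<le> cf * s"
          using f_calm(3)[of x] x e mult_left_mono[OF s(2) f_calm(1)] by linarith
        have "norm (D x - A) \<le> cD * s"
          using D_calm(3)[of x] x e mult_left_mono[OF s(2) D_calm(1)] by linarith
        then show "norm (adj (D x - A) l) \<le> cD * s * M"
          using nl D_calm(1) s by (intro order_trans[OF norm_adj_le] mult_mono) auto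
        show "norm (adj A (l - \<mu>)) \<le> norm A * (c2 * s)"
          using l\<mu> by (intro order_trans[OF norm_adj_le] mult_left_mono) auto
      qed
      finally show ?thesis by (simp add: c3_def algebra_simps)
    qed
    obtain l' where l': "l' \<in> multipliers f \<Phi> \<Theta> xb" "norm (\<mu> - l') \<le> \<kappa> * norm (adj A (\<mu> - lb))"
      using \<kappa>(2)[OF \<mu>(1) n\<mu>] by blast
    have "norm (l - l') \<le> norm (l - \<mu>) + norm (\<mu> - l')"
      using norm_triangle_ineq[of "l - \<mu>" "\<mu> - l'"] by simp
    also have "\<dots> \<le> c2 * s + \<kappa> * (c3 * s)"
      using l\<mu> l'(2) mult_left_mono[OF A\<mu> \<kappa>(1)] by linarith
    also have "\<dots> = (c2 + \<kappa> * c3) * s" by (simp add: algebra_simps)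
    \<comment> \<open>By the primal estimate \<open>s\<close> is at most
      \<open>(1 + c1) * q\<close>, so only the residuals remain.\<close>
    also have "\<dots> \<le> (c2 + \<kappa> * c3) * ((1 + c1) * q)"
      using primal c2 c3 \<kappa>(1) by (intro mult_left_mono) (auto simp: s_def algebra_simps)
    finally have "norm (x - xb) + norm (l - l') \<le> c * q"
      using primal by (simp add: c_def algebra_simps)
    with l'(1) show "\<exists>l'\<in>multipliers f \<Phi> \<Theta> xb.
        norm (x - xb) + norm (l - l') \<le> c * (norm (Psi f \<Phi> x l) + norm w)"
      by (auto simp: q_def v_def)
  qed
qed

end

section \<open>Equivalence with the error bounds\<close>

lemma ext_dist_nonneg: "0 \<le> ext_dist x S"
  by (simp add: ext_dist_def INF_greatest)

lemma ext_dist_le: "y \<in> S \<Longrightarrow> ext_dist x S \<le> ereal (dist x y)"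
  unfolding ext_dist_def by (rule INF_lower)

context variational_system
begin

text \<open>Every \<open>p\<close> in the inclusion has first component \<open>xb\<close>, so
  comparing first components gives the bound on \<open>norm (x - xb)\<close> that
  \<open>estimate_imp_noncritical\<close> asks for.\<close>

lemma semi_isolated_calmness_imp_noncritical:
  assumes "semi_isolated_calmness f \<Phi> \<Theta> xb lb"
  shows "noncritical f \<Phi> \<Theta> xb lb"
proof -
  obtain \<epsilon> c V W where \<epsilon>: "0 < \<epsilon>" "0 \<le> c" "open V" "0 \<in> V" "open W" "0 \<in> W"
    and sub: "\<forall>v\<in>V. \<forall>w\<in>W. solution_map f \<Phi> \<Theta> v w \<inter> cball (xb, lb) \<epsilon>
      \<subseteq> {p + (c * (norm v + norm w)) *\<^sub>R b | p b.
            p \<in> {xb} \<times> multipliers f \<Phi> \<Theta> xb \<and> b \<in> cball 0 1}"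
    using assms unfolding semi_isolated_calmness_def by (elim exE conjE) (rule that)
  obtain eV eW where eV: "0 < eV" "ball 0 eV \<subseteq> V" and eW: "0 < eW" "ball 0 eW \<subseteq> W"
    using \<epsilon> by (meson openE)
  \<comment> \<open>The norm of a pair is at most the sum of the norms of its parts, hence the half
    of \<open>\<epsilon>\<close>.\<close>
  define e where "e = Min {\<epsilon> / 2, eV, eW}"
  have e: "0 < e" "e \<le> \<epsilon> / 2" "e \<le> eV" "e \<le> eW"
    using \<epsilon>(1) eV(1) eW(1) by (auto simp: e_def)
  show ?thesis
  proof (rule estimate_imp_noncritical[OF e(1)])
    fix x l w assume x: "norm (x - xb) < e" and l: "norm (l - lb) < e" and w: "norm w < e"
      and v: "norm (Psi f \<Phi> x l) < e" and ln: "l \<in> normal_cone \<Theta> (\<Phi> x + w)"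
    let ?q = "norm (Psi f \<Phi> x l) + norm w"
    have V: "Psi f \<Phi> x l \<in> V" and W: "w \<in> W"
      using v w e eV eW by (auto simp: subset_iff)
    have "dist (xb, lb) (x, l) \<le> \<epsilon>"
      using norm_Pair_le[of "x - xb" "l - lb"] x l e(2)
      by (simp add: dist_commute dist_norm flip: diff_Pair)
    then have "(x, l) \<in> solution_map f \<Phi> \<Theta> (Psi f \<Phi> x l) w \<inter> cball (xb, lb) \<epsilon>"
      using ln by (simp add: solution_map_def)
    from subsetD[OF bspec[OF bspec[OF sub V] W] this]
    obtain p b where pb: "(x, l) = p + (c * ?q) *\<^sub>R b"
      "p \<in> {xb} \<times> multipliers f \<Phi> \<Theta> xb" "norm b \<le> 1"
      by (simp only: mem_Collect_eq mem_cball_0) blast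
    have "fst p = xb" using pb(2) by auto
    with arg_cong[OF pb(1), of fst] have "x = xb + (c * ?q) *\<^sub>R fst b" by simp
    then have "x - xb = (c * ?q) *\<^sub>R fst b" by (metis add_diff_cancel_left')
    then have "norm (x - xb) = c * ?q * norm (fst b)"
      using \<epsilon>(2) by (simp add: abs_mult)
    also have "\<dots> \<le> c * ?q * 1"
      using norm_fst_le[of "fst b" "snd b"] pb(3) \<epsilon>(2) by (intro mult_left_mono) auto
    finally show "norm (x - xb) \<le> c * ?q" by simp
  qed
qed

text \<open>If \<open>l\<close> is normal at \<open>\<Phi> x + w\<close>, this point lies in the
  inverse normal cone, so \<open>norm w\<close> bounds the distance to it from
  \<open>\<Phi> x\<close>.\<close>

lemma error_bound_imp_noncritical:
  assumes "error_bound f \<Phi> \<Theta> xb lb"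
  shows "noncritical f \<Phi> \<Theta> xb lb"
proof -
  from assms obtain \<epsilon> c where \<epsilon>: "0 < \<epsilon>" "0 \<le> c"
    and eb: "\<And>x l. (x, l) \<in> cball (xb, lb) \<epsilon> \<Longrightarrow>
        ereal (norm (x - xb)) + ext_dist l (multipliers f \<Phi> \<Theta> xb)
          \<le> ereal c * (ereal (norm (Psi f \<Phi> x l)) + ext_dist (\<Phi> x) (inverse_normal_cone \<Theta> l))"
    unfolding error_bound_def by blast
  show ?thesis
  proof (rule estimate_imp_noncritical[of "\<epsilon> / 2"])
    fix x l w assume x: "norm (x - xb) < \<epsilon> / 2" and l: "norm (l - lb) < \<epsilon> / 2"
      and ln: "l \<in> normal_cone \<Theta> (\<Phi> x + w)"
    have "dist (xb, lb) (x, l) \<le> \<epsilon>"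
      using norm_Pair_le[of "x - xb" "l - lb"] x l
      by (simp add: dist_commute dist_norm flip: diff_Pair)
    then have cb: "(x, l) \<in> cball (xb, lb) \<epsilon>" by simp
    have "ereal (norm (x - xb)) \<le> ereal (norm (x - xb)) + ext_dist l (multipliers f \<Phi> \<Theta> xb)"
      by (intro add_increasing2 ext_dist_nonneg order_refl)
    also note eb[OF cb]
    also have "ext_dist (\<Phi> x) (inverse_normal_cone \<Theta> l) \<le> ereal (norm w)"
      using ext_dist_le[of "\<Phi> x + w" "inverse_normal_cone \<Theta> l" "\<Phi> x"] ln
      by (simp add: inverse_normal_cone_def dist_norm)
    then have "ereal c * (ereal (norm (Psi f \<Phi> x l)) + ext_dist (\<Phi> x) (inverse_normal_cone \<Theta> l))
        \<le> ereal c * (ereal (norm (Psi f \<Phi> x l)) + ereal (norm w))"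
      using \<epsilon>(2) by (intro ereal_mult_left_mono add_left_mono) auto
    finally show "norm (x - xb) \<le> c * (norm (Psi f \<Phi> x l) + norm w)" by simp
  qed (use \<epsilon> in simp)
qed

lemma estimate_imp_semi_isolated_calmness:
  assumes e: "0 < e" "0 \<le> c" and est: "\<And>x l w. norm (x - xb) < e \<Longrightarrow> norm (l - lb) < e \<Longrightarrow>
      norm w < e \<Longrightarrow> l \<in> normal_cone \<Theta> (\<Phi> x + w) \<Longrightarrow>
      \<exists>l'\<in>multipliers f \<Phi> \<Theta> xb. norm (x - xb) + norm (l - l') \<le> c * (norm (Psi f \<Phi> x l) + norm w)"
  shows "semi_isolated_calmness f \<Phi> \<Theta> xb lb"
  unfolding semi_isolated_calmness_def
\<comment> \<open>The estimate puts no bound on \<open>Psi f \<Phi> x l\<close>, so the whole space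
  serves as \<open>V\<close>.\<close>
proof (rule exI[of _ "e / 2"], rule exI[of _ c], rule exI[of _ UNIV], rule exI[of _ "ball 0 e"],
    intro conjI ballI subsetI)
  fix v w and y :: "'a \<times> 'b"
  assume w: "w \<in> ball 0 e" and y: "y \<in> solution_map f \<Phi> \<Theta> v w \<inter> cball (xb, lb) (e / 2)"
  obtain x l where xl: "y = (x, l)" by (cases y)
  have cb: "dist (xb, lb) (x, l) \<le> e / 2" and v: "v = Psi f \<Phi> x l" and ln: "l \<in> normal_cone \<Theta> (\<Phi> x + w)"
    using y by (auto simp: xl solution_map_def)
  have "norm (x - xb) < e" "norm (l - lb) < e"
    using dist_fst_le[of "(xb, lb)" "(x, l)"] dist_snd_le[of "(xb, lb)" "(x, l)"] cb e(1)
    by (simp_all add: dist_norm norm_minus_commute)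
  with est[of x l w] w ln obtain l' where l': "l' \<in> multipliers f \<Phi> \<Theta> xb"
    "norm (x - xb) + norm (l - l') \<le> c * (norm v + norm w)"
    by (auto simp: v)
  define s where "s = c * (norm v + norm w)"
  define b where "b = (x - xb, l - l') /\<^sub>R s"
  have nb: "norm (x - xb, l - l') \<le> s"
    using norm_Pair_le[of "x - xb" "l - l'"] l'(2) by (simp add: s_def)
  have "y = (xb, l') + s *\<^sub>R b \<and> norm b \<le> 1"
  proof (cases "s = 0")
    case True
    \<comment> \<open>The inverse of 0 is 0, so \<open>b = 0\<close>, and \<open>nb\<close> gives
      \<open>x = xb\<close> and \<open>l = l'\<close>.\<close>
    then show ?thesis using nb by (simp add: b_def xl zero_prod_def)
  next
    case False
    then have "0 < s" using e(2) by (simp add: s_def less_le)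
    then show ?thesis using nb by (simp add: b_def xl field_simps del: scaleR_Pair)
  qed
  then show "y \<in> {p + (c * (norm v + norm w)) *\<^sub>R b | p b.
      p \<in> {xb} \<times> multipliers f \<Phi> \<Theta> xb \<and> b \<in> cball 0 1}"
    using l'(1) unfolding s_def by fastforce
qed (use e in auto)

text \<open>The estimate is applied with \<open>w = z - \<Phi> x\<close> for each nearby
  \<open>z\<close> in the inverse normal cone; a \<open>z\<close> too far away for this makes the
  right side large by itself. The infimum over \<open>z\<close> comes last.\<close>

lemma estimate_imp_error_bound:
  assumes e: "0 < e" "0 \<le> c" and est: "\<And>x l w. norm (x - xb) < e \<Longrightarrow> norm (l - lb) < e \<Longrightarrow>
      norm w < e \<Longrightarrow> l \<in> normal_cone \<Theta> (\<Phi> x + w) \<Longrightarrow>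
      \<exists>l'\<in>multipliers f \<Phi> \<Theta> xb. norm (x - xb) + norm (l - l') \<le> c * (norm (Psi f \<Phi> x l) + norm w)"
  shows "error_bound f \<Phi> \<Theta> xb lb"
proof -
  let ?\<Lambda> = "multipliers f \<Phi> \<Theta> xb"
  \<comment> \<open>\<open>C\<close> is at least 1 for the distant \<open>z\<close>, and positive
    for the infinite distance and for moving the factor out of the infimum.\<close>
  define C where "C = c + 1"
  have C: "0 < C" using e by (simp add: C_def)
  have "ereal (norm (x - xb)) + ext_dist l ?\<Lambda>
      \<le> ereal C * (ereal (norm (Psi f \<Phi> x l)) + ext_dist (\<Phi> x) (inverse_normal_cone \<Theta> l))"
    if "(x, l) \<in> cball (xb, lb) (e / 2)" for x l
  proof -
    have near: "norm (x - xb) \<le> e / 2" "norm (l - lb) \<le> e / 2"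
      using dist_fst_le[of "(xb, lb)" "(x, l)"] dist_snd_le[of "(xb, lb)" "(x, l)"] that
      by (simp_all add: dist_norm norm_minus_commute)
    let ?L = "ereal (norm (x - xb)) + ext_dist l ?\<Lambda>"
    let ?v = "norm (Psi f \<Phi> x l)"
    have *: "?L \<le> ereal (C * (?v + dist (\<Phi> x) z))" if z: "z \<in> inverse_normal_cone \<Theta> l" for z
    proof (cases "dist (\<Phi> x) z < e")
      case True
      have "l \<in> normal_cone \<Theta> (\<Phi> x + (z - \<Phi> x))" using z by (simp add: inverse_normal_cone_def)
      with est[of x l "z - \<Phi> x"] near True e obtain l' where l': "l' \<in> ?\<Lambda>"
        "norm (x - xb) + norm (l - l') \<le> c * (?v + norm (z - \<Phi> x))"
        by (auto simp: dist_norm norm_minus_commute)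
      have "?L \<le> ereal (norm (x - xb)) + ereal (norm (l - l'))"
        using ext_dist_le[OF l'(1), of l] by (intro add_left_mono) (simp add: dist_norm)
      also have "\<dots> \<le> ereal (C * (?v + dist (\<Phi> x) z))"
      proof -
        have "c * (?v + norm (z - \<Phi> x)) \<le> C * (?v + norm (z - \<Phi> x))"
          by (intro mult_right_mono) (simp_all add: C_def)
        with l'(2) have "norm (x - xb) + norm (l - l') \<le> C * (?v + norm (z - \<Phi> x))"
          by linarith
        then show ?thesis by (simp add: dist_norm norm_minus_commute)
      qed
      finally show ?thesis .
    next
      case False
      \<comment> \<open>As \<open>lb\<close> is itself a multiplier, the left side is at most
        \<open>e\<close>, which the distance to \<open>z\<close> already reaches.\<close>
      have "?L \<le> ereal (norm (x - xb)) + ereal (norm (l - lb))"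
        using ext_dist_le[OF lb, of l] by (intro add_left_mono) (simp add: dist_norm)
      also have "\<dots> \<le> ereal e" using near by simp
      also have "\<dots> \<le> ereal (C * (?v + dist (\<Phi> x) z))"
      proof -
        have "e \<le> ?v + dist (\<Phi> x) z"
          using False norm_ge_zero[of "Psi f \<Phi> x l"] by linarith
        then have "1 * e \<le> C * (?v + dist (\<Phi> x) z)"
          using e by (intro mult_mono) (auto simp: C_def)
        then show ?thesis by simp
      qed
      finally show ?thesis .
    qed
    show ?thesis
    proof (cases "inverse_normal_cone \<Theta> l = {}")
      case True
      \<comment> \<open>The distance to the empty set is infinite, and with \<open>C\<close>
        positive so is the right side.\<close>
      then show ?thesis using C by (simp add: ext_dist_def top_ereal_def)
    next
      case False
      have "?L \<le> (INF z\<in>inverse_normal_cone \<Theta> l. ereal C * (ereal ?v + ereal (dist (\<Phi> x) z)))"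
        using * by (intro INF_greatest) simp
      also have "\<dots> = ereal C * (INF z\<in>inverse_normal_cone \<Theta> l. ereal ?v + ereal (dist (\<Phi> x) z))"
        using ereal_Inf_cmult[OF C, of "\<lambda>y. y \<in> (\<lambda>z. ereal ?v + ereal (dist (\<Phi> x) z)) ` inverse_normal_cone \<Theta> l"]
        by (simp add: image_image setcompr_eq_image del: plus_ereal.simps times_ereal.simps)
      also have "(INF z\<in>inverse_normal_cone \<Theta> l. ereal ?v + ereal (dist (\<Phi> x) z))
          = ereal ?v + ext_dist (\<Phi> x) (inverse_normal_cone \<Theta> l)"
        using False unfolding ext_dist_def by (intro INF_ereal_add_right) auto
      finally show ?thesis .
    qed
  qed
  then show ?thesis
    unfolding error_bound_def using e(1) C
    by (intro exI[of _ "e / 2"] exI[of _ C]) auto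
qed

end

theorem theorem5p10:
  fixes f :: "'a::euclidean_space \<Rightarrow> 'a"
    and \<Phi> :: "'a \<Rightarrow> 'b::euclidean_space"
    and \<Theta> :: "'b set"
    and C :: "'e::euclidean_space set"
    and xb :: 'a and lb :: 'b
  assumes "\<And>x. f differentiable (at x)"
    and "twice_differentiable \<Phi>"
    and "closed \<Theta>"
    and "\<Phi> xb \<in> \<Theta>"
    and "stationary f \<Phi> \<Theta> xb"
    and "C2_cone_reducible \<Theta> (\<Phi> xb) C"
    and "strict_complementarity f \<Phi> \<Theta> xb"
    and "lb \<in> multipliers f \<Phi> \<Theta> xb"
  shows "(noncritical f \<Phi> \<Theta> xb lb \<longleftrightarrow> semi_isolated_calmness f \<Phi> \<Theta> xb lb) \<and>
         (noncritical f \<Phi> \<Theta> xb lb \<longleftrightarrow> error_bound f \<Phi> \<Theta> xb lb)"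
proof -
  obtain f' where f': "(f has_derivative f') (at xb)"
    using assms(1) unfolding differentiable_def by blast
  obtain D :: "'a \<Rightarrow> 'a \<Rightarrow>\<^sub>L 'b" and D2 where
    D: "\<And>x. (\<Phi> has_derivative blinfun_apply (D x)) (at x)" "(D has_derivative D2) (at xb)"
    using assms(2) unfolding twice_differentiable_def differentiable_def by blast
  interpret variational_system f f' \<Phi> D D2 \<Theta> xb lb
    using f' D assms(8) by unfold_locales
  obtain U Q F DF DDF where st: "straightened_set \<Theta> U Q F DF DDF (\<Phi> xb)"
    using assms(6) by (rule C2_cone_reducible_straightened)
  interpret straightened_set \<Theta> U Q F DF DDF "\<Phi> xb" by (fact st)
  obtain l0 where l0: "l0 \<in> multipliers f \<Phi> \<Theta> xb" "l0 \<in> rel_interior (normal_cone \<Theta> (\<Phi> xb))"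
    using assms(7) unfolding strict_complementarity_def by blast
  interpret reducible_system f f' \<Phi> D D2 \<Theta> xb lb U Q F DF DDF l0
    using l0 by unfold_locales
  have "semi_isolated_calmness f \<Phi> \<Theta> xb lb \<and> error_bound f \<Phi> \<Theta> xb lb"
    if "noncritical f \<Phi> \<Theta> xb lb"
    using noncritical_imp_estimate[OF that] estimate_imp_semi_isolated_calmness estimate_imp_error_bound
    by metis
  then show ?thesis
    using semi_isolated_calmness_imp_noncritical error_bound_imp_noncritical by blast
qed

end
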